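(* Let $x$ be an abstract vector variable, $Y=\{y_1,\dots,y_N\}$ a finite set of further abstract vector variables, $I\subset\{1,\dots,N\}$, $p=|I|$, and $A\in\mathcal A_x(Y)$. Then $$\mathcal H^Y_{x,q}((x\wedge y_I)A)=(x\wedge y_I)\,\Delta^Y_{p,q}A,\qquad \mathcal H^Y_{x,q}(y_IA)=y_I\,\Delta^Y_{p,q}A+\mathcal N^Y_{I,q}(A),$$ where $$\mathcal N^Y_{I,q}(A):=q^{m-p}(x\wedge y_I)\,\partial^{\mathrm{sc},Y}_{x,q}(A)+\mathcal C^Y_x\bigl(y_I\,\partial^{\mathrm{sc},Y}_{x,q}(A)\bigr)-(-1)^pq^{m-p}\,y_I\,E^{\mathrm{sc},Y}_{x,q}A\ \in\ \mathcal X_{x;Y}.$$ Let $\mathcal N^Y_{x,q}:\mathcal Y_{x;Y}\to\mathcal X_{x;Y}$ be determined by $\mathcal N^Y_{x,q}(y_IA)=\mathcal N^Y_{I,q}(A)$. Hence, relative to $\mathcal Y_{x;Y}\oplus\mathcal X_{x;Y}$, $$\mathcal H^Y_{x,q}=\begin{pmatrix}\bigoplus_I\Delta^Y_{|I|,q}&0\\ \mathcal N^Y_{x,q}&\bigoplus_I\Delta^Y_{|I|,q}\end{pmatrix}.$$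
   Context: **Radial algebra.** For a set $S$ of abstract vector variables, $R(S)$ is the associative unital $\mathbb R$-algebra generated by $S$ subject to $[\{u,v\},w]=0$ for all $u,v,w\in S$, where $\{a,b\}=ab+ba$, $[a,b]=ab-ba$. The wedge is the antisymmetrized product $u_1\wedge\cdots\wedge u_p=\frac1{p!}\sum_{\pi}\operatorname{sgn}(\pi)u_{\pi(1)}\cdots u_{\pi(p)}$ (empty wedge $=1$). **Coefficients.** $q,Q$ are algebraically independent indeterminates, $\mathbb B=\mathbb R[q,q^{-1},Q,(1-q)^{-1}]$, $R_{\mathbb B}(S)=\mathbb B\otimes_{\mathbb R}R(S)$. For integers $n,a$: $[n]_q=\frac{1-q^n}{1-q}$, $q^{m+a}:=Qq^a$, $[m+a]_q:=\frac{1-Qq^a}{1-q}$ ($m$ is only a formal symbol). **Scalars.** $r=x^2$, $s_i=\{x,y_i\}$, $c_{ij}=\{y_i,y_j\}=c_{ji}$ are central and $\mathcal A_x(Y)=\mathbb B[r,s_1,\dots,s_N,c_{ij}:1\le i\le j\le N]$ is a polynomial algebra. For $I=\{i_1<\cdots<i_p\}\subset\{1,\dots,N\}$, $y_I=y_{i_1}\wedge\cdots\wedge y_{i_p}$, $y_\varnothing=1$. It is known that $R_{\mathbb B}(\{x\}\cup Y)=\mathcal Y_{x;Y}\oplus\mathcal X_{x;Y}$ with $\mathcal Y_{x;Y}=\bigoplus_I y_I\mathcal A_x(Y)$, $\mathcal X_{x;Y}=\bigoplus_I(x\wedge y_I)\mathcal A_x(Y)$, free over $\mathcal A_x(Y)$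 on the elements $y_I,\ x\wedge y_I$. **Jackson operators.** For a scalar variable $u$ and parameter $P$: $\delta^{(u)}_Pf=\frac{f(u)-f(Pu)}{(1-P)u}$, $T^{(u)}_Pf(u)=f(Pu)$, $M_u$ is multiplication by $u$. For $A\in\mathcal A_x(Y)$, $$\partial^{\mathrm{sc},Y}_{x,q}A=(1+q)\,x\,\delta^{(r)}_{q^2}A+2\sum_{i=1}^N y_i\,T^{(r)}_{q^2}\delta^{(s_i)}_qA,\qquad E^{\mathrm{sc},Y}_{x,q}=(1+q)M_r\delta^{(r)}_{q^2}+T^{(r)}_{q^2}\sum_{i=1}^NM_{s_i}\delta^{(s_i)}_q .$$ **Finite relative right $q$-vector derivative.** $\partial^{Y,\mathrm R}_{x,q}$ is the $\mathbb B$-linear operator on $R_{\mathbb B}(\{x\}\cup Y)$ with, for $p=|I|$ and $A,B\in\mathcal A_x(Y)$, $$\partial^{Y,\mathrm R}_{x,q}(y_IA)=y_I\,\partial^{\mathrm{sc},Y}_{x,q}(A),\qquad \partial^{Y,\mathrm R}_{x,q}((x\wedge y_I)B)=(-1)^p[m-p]_q\,y_IB+q^{m-p}(x\wedge y_I)\,\partial^{\mathrm{sc},Y}_{x,q}(B).$$ **Exterior creation and anticommutator.** $\mathcal C^Y_x(y_IA)=(x\wedge y_I)A$, $\mathcal C^Y_x((x\wedge y_I)B)=0$, extended additively; $\mathcal H^Y_{x,q}:=\partial^{Y,\mathrm R}_{x,q}\mathcal C^Y_x+\mathcal C^Y_x\partial^{Y,\mathrm R}_{x,q}$. **Diagonal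 operators.** On $\mathcal A_x(Y)$: $\Delta^Y_{p,q}:=(-1)^p\bigl([m-p]_q\,\mathrm{Id}+q^{m-p}E^{\mathrm{sc},Y}_{x,q}\bigr)$. The symbol $\bigoplus_I\Delta^Y_{|I|,q}$ denotes $y_IA\mapsto y_I\Delta^Y_{|I|,q}A$ on $\mathcal Y_{x;Y}$ and $(x\wedge y_I)A\mapsto(x\wedge y_I)\Delta^Y_{|I|,q}A$ on $\mathcal X_{x;Y}$. Block matrices act on column vectors with components in $\mathcal Y_{x;Y}$, $\mathcal X_{x;Y}$ (in this order). *)

theory Defs
  imports
    Complex_Main
    "HOL-Library.Poly_Mapping"
    "HOL-Library.FuncSet"
    "HOL-Combinatorics.Permutations"
    "HOL-Computational_Algebra.Polynomial"
    "HOL-Computational_Algebra.Fraction_Field"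
begin

section \<open>The radial algebra over a coefficient ring\<close>

text \<open>The free monoid on \<open>'v\<close>, written additively so that the monoid algebra
  \<open>'v word \<Rightarrow>\<^sub>0 'k\<close> is the free associative unital \<open>'k\<close>-algebra on \<open>'v\<close>.\<close>

datatype 'v word = Word (letters: "'v list")

instantiation word :: (type) monoid_add
begin
definition "0 = Word []"
definition "u + w = Word (letters u @ letters w)"
instance by standard (simp_all add: zero_word_def plus_word_def)
end

definition free_var :: "'v \<Rightarrow> ('v word \<Rightarrow>\<^sub>0 'k::comm_ring_1)" where
  "free_var v = Poly_Mapping.single (Word [v]) 1"

definition free_const :: "'k \<Rightarrow> ('v word \<Rightarrow>\<^sub>0 'k::comm_ring_1)" where
  "free_const c = Poly_Mapping.single 0 c"

definition anticomm :: "'a::ring \<Rightarrow> 'a \<Rightarrow> 'a" where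
  "anticomm a b = a * b + b * a"

definition comm :: "'a::ring \<Rightarrow> 'a \<Rightarrow> 'a" where
  "comm a b = a * b - b * a"

text \<open>The two-sided ideal generated by all \<open>[{u,v},w]\<close>.\<close>

inductive_set radial_ideal :: "('v word \<Rightarrow>\<^sub>0 'k::comm_ring_1) set" where
  zero: "0 \<in> radial_ideal"
| add_rel: "i \<in> radial_ideal \<Longrightarrow>
    a * comm (anticomm (free_var u) (free_var v)) (free_var w) * b + i \<in> radial_ideal"

lemma radial_ideal_add: "i \<in> radial_ideal \<Longrightarrow> j \<in> radial_ideal \<Longrightarrow> i + j \<in> radial_ideal"
proof (induction rule: radial_ideal.induct)
  case (add_rel i a u v w b)
  then show ?case
    using radial_ideal.add_rel[of "i + j" a u v w b] by (simp add: add.assoc)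
qed simp

lemma radial_ideal_mult: "i \<in> radial_ideal \<Longrightarrow> c * i * d \<in> radial_ideal"
proof (induction rule: radial_ideal.induct)
  case (add_rel i a u v w b)
  then show ?case
    using radial_ideal.add_rel[of "c * i * d" "c * a" u v w "b * d"]
    by (simp add: mult.assoc distrib_left distrib_right)
qed (simp add: radial_ideal.zero)

lemma radial_ideal_uminus: "i \<in> radial_ideal \<Longrightarrow> - i \<in> radial_ideal"
  using radial_ideal_mult[of i "- 1" 1] by simp

lemma radial_ideal_diff: "i \<in> radial_ideal \<Longrightarrow> j \<in> radial_ideal \<Longrightarrow> i - j \<in> radial_ideal"
  using radial_ideal_add[of i "- j"] radial_ideal_uminus[of j] by simp

definition radial_eq :: "('v word \<Rightarrow>\<^sub>0 'k::comm_ring_1) \<Rightarrow> ('v word \<Rightarrow>\<^sub>0 'k) \<Rightarrow> bool" where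
  "radial_eq f g \<longleftrightarrow> f - g \<in> radial_ideal"

lemma radial_eq_sym: "radial_eq f g \<Longrightarrow> radial_eq g f"
  unfolding radial_eq_def by (drule radial_ideal_uminus) simp

lemma radial_eq_trans: "radial_eq f g \<Longrightarrow> radial_eq g h \<Longrightarrow> radial_eq f h"
  unfolding radial_eq_def by (drule (1) radial_ideal_add) simp

lemma equivp_radial_eq: "equivp radial_eq"
proof (rule equivpI)
  show "reflp radial_eq" by (simp add: reflp_def radial_eq_def radial_ideal.zero)
  show "symp radial_eq" by (rule sympI) (rule radial_eq_sym)
  show "transp radial_eq" by (rule transpI) (rule radial_eq_trans)
qed

text \<open>The radial algebra on the variable set \<open>'v\<close>, presented over the coefficient ring \<open>'k\<close>.
  Thus \<open>('v, real) radial\<close> is \<open>R(S)\<close> with \<open>S = UNIV :: 'v set\<close>; that \<open>('v, 'k) radial\<close> is the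
  extension of scalars of \<open>R(S)\<close> to \<open>'k\<close> is lemma \<open>radial_base_change\<close> below.\<close>

quotient_type (overloaded) ('v, 'k) radial = "'v word \<Rightarrow>\<^sub>0 'k::comm_ring_1" / radial_eq
  by (rule equivp_radial_eq)

definition free_eval :: "('k \<Rightarrow> 'c) \<Rightarrow> ('v \<Rightarrow> 'c) \<Rightarrow> ('v word \<Rightarrow>\<^sub>0 'k::comm_ring_1) \<Rightarrow> 'c::ring_1" where
  "free_eval \<phi> g f = (\<Sum>w\<in>Poly_Mapping.keys f. \<phi> (Poly_Mapping.lookup f w) * prod_list (map g (letters w)))"

definition is_ring_hom :: "('a::ring_1 \<Rightarrow> 'b::ring_1) \<Rightarrow> bool" where
  "is_ring_hom F \<longleftrightarrow> F 1 = 1 \<and> (\<forall>a b. F (a + b) = F a + F b) \<and> (\<forall>a b. F (a * b) = F a * F b)"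

lemma is_ring_hom_0: "is_ring_hom F \<Longrightarrow> F 0 = 0"
  unfolding is_ring_hom_def by (metis add_0_right add_left_cancel)

lemma is_ring_hom_diff: "is_ring_hom F \<Longrightarrow> F (a - b) = F a - F b"
  using eq_diff_eq[of "F (a - b)" "F a" "F b"] unfolding is_ring_hom_def
  by (metis diff_add_cancel)

lemma free_eval_superset:
  assumes "is_ring_hom \<phi>" "finite K" "Poly_Mapping.keys f \<subseteq> K"
  shows "free_eval \<phi> g f = (\<Sum>w\<in>K. \<phi> (Poly_Mapping.lookup f w) * prod_list (map g (letters w)))"
  unfolding free_eval_def
  by (rule sum.mono_neutral_left) (use assms in \<open>auto simp: in_keys_iff is_ring_hom_0\<close>)

lemma free_eval_add:
  assumes "is_ring_hom \<phi>"
  shows "free_eval \<phi> g (a + b) = free_eval \<phi> g a + free_eval \<phi> g b"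
proof -
  let ?K = "Poly_Mapping.keys a \<union> Poly_Mapping.keys b"
  have "Poly_Mapping.keys (a + b) \<subseteq> ?K" by (rule Poly_Mapping.keys_add)
  then show ?thesis
    using assms
    by (simp add: free_eval_superset[OF assms, of ?K] lookup_add is_ring_hom_def distrib_right sum.distrib)
qed

lemma free_eval_single:
  assumes "is_ring_hom \<phi>"
  shows "free_eval \<phi> g (Poly_Mapping.single w c) = \<phi> c * prod_list (map g (letters w))"
  using free_eval_superset[OF assms, of "{w}" "Poly_Mapping.single w c" g]
  by simp

lemma poly_mapping_add_induct [case_names zero single add]:
  assumes "P 0" "\<And>w c. P (Poly_Mapping.single w c)" "\<And>a b. P a \<Longrightarrow> P b \<Longrightarrow> P (a + b)"
  shows "P (f :: 'a \<Rightarrow>\<^sub>0 'b::comm_monoid_add)"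
proof (induction f rule: update_induct)
  case const
  then show ?case using assms(1) by simp
next
  case (update f a b)
  have "Poly_Mapping.update a b f = Poly_Mapping.single a b + f"
    by (rule poly_mapping_eqI)
      (use update(1) in \<open>auto simp: lookup_update lookup_add lookup_single when_def in_keys_iff\<close>)
  then show ?case using assms update by simp
qed

lemma free_eval_mult:
  assumes \<phi>: "is_ring_hom \<phi>" and comm: "\<And>c v. \<phi> c * g v = g v * \<phi> c"
  shows "free_eval \<phi> g (a * b) = free_eval \<phi> g a * free_eval \<phi> g b"
proof -
  have z: "free_eval \<phi> g 0 = 0" by (simp add: free_eval_def)
  have cl: "prod_list (map g l) * \<phi> c = \<phi> c * prod_list (map g l)" for l c
  proof (induction l)
    case (Cons v l)
    have "g v * (prod_list (map g l) * \<phi> c) = (g v * \<phi> c) * prod_list (map g l)"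
      by (simp only: Cons mult.assoc)
    also have "\<dots> = \<phi> c * (g v * prod_list (map g l))"
      by (simp only: comm[symmetric] mult.assoc)
    finally show ?case by (simp add: mult.assoc)
  qed simp
  have s: "free_eval \<phi> g (Poly_Mapping.single w c * b) = free_eval \<phi> g (Poly_Mapping.single w c) * free_eval \<phi> g b"
    for w c
  proof (induction b rule: poly_mapping_add_induct)
    case (single w' c')
    have "\<phi> c * \<phi> c' * (prod_list (map g (letters w)) * prod_list (map g (letters w')))
        = \<phi> c * prod_list (map g (letters w)) * (\<phi> c' * prod_list (map g (letters w')))"
    proof -
      have "\<phi> c * prod_list (map g (letters w)) * (\<phi> c' * prod_list (map g (letters w')))
          = \<phi> c * (prod_list (map g (letters w)) * \<phi> c') * prod_list (map g (letters w'))"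
        by (simp only: mult.assoc)
      then show ?thesis by (simp only: cl mult.assoc)
    qed
    then show ?case
      using \<phi> by (simp add: mult_single free_eval_single[OF \<phi>] plus_word_def is_ring_hom_def)
  qed (simp_all add: z distrib_left free_eval_add[OF \<phi>])
  show ?thesis
    by (induction a rule: poly_mapping_add_induct)
      (simp_all add: z distrib_right free_eval_add[OF \<phi>] s)
qed

lemma free_eval_hom:
  assumes "is_ring_hom \<phi>" "\<And>c v. \<phi> c * g v = g v * \<phi> c"
  shows "is_ring_hom (free_eval \<phi> g)"
proof -
  have "free_eval \<phi> g 1 = 1"
    using free_eval_single[OF assms(1), of g 0 1] assms(1)
    by (simp add: is_ring_hom_def zero_word_def[symmetric]) (simp add: zero_word_def)
  then show ?thesis
    by (simp add: is_ring_hom_def free_eval_mult[OF assms] free_eval_add[OF assms(1)])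
qed

lemma free_eval_var: "is_ring_hom \<phi> \<Longrightarrow> free_eval \<phi> g (free_var v) = g v"
  by (simp add: free_var_def free_eval_single is_ring_hom_def)

lemma free_eval_const: "is_ring_hom \<phi> \<Longrightarrow> free_eval \<phi> g (free_const c) = \<phi> c"
  by (simp add: free_const_def free_eval_single zero_word_def)

lemma hom_radial_ideal:
  assumes F: "is_ring_hom F"
    and rel: "\<And>u v w. comm (anticomm (F (free_var u)) (F (free_var v))) (F (free_var w)) = 0"
    and "i \<in> radial_ideal"
  shows "F i = 0"
  using assms(3)
proof (induction rule: radial_ideal.induct)
  case (add_rel i a u v w b)
  have "F (comm (anticomm (free_var u) (free_var v)) (free_var w)) = 0"
    using rel[of u v w] F is_ring_hom_diff[OF F]
    by (simp add: comm_def anticomm_def is_ring_hom_def)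
  then show ?case using F add_rel by (simp add: is_ring_hom_def)
qed (rule is_ring_hom_0[OF F])

instantiation radial :: (type, comm_ring_1) ring_1
begin

lift_definition zero_radial :: "('a, 'b) radial" is 0 .

lift_definition one_radial :: "('a, 'b) radial" is 1 .

lift_definition plus_radial :: "('a, 'b) radial \<Rightarrow> ('a, 'b) radial \<Rightarrow> ('a, 'b) radial" is "(+)"
  unfolding radial_eq_def add_diff_add by (rule radial_ideal_add)

lift_definition uminus_radial :: "('a, 'b) radial \<Rightarrow> ('a, 'b) radial" is uminus
  unfolding radial_eq_def minus_diff_minus by (rule radial_ideal_uminus)

lift_definition minus_radial :: "('a, 'b) radial \<Rightarrow> ('a, 'b) radial \<Rightarrow> ('a, 'b) radial" is "(-)"
  unfolding radial_eq_def by (drule (1) radial_ideal_diff) (simp add: algebra_simps)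

lift_definition times_radial :: "('a, 'b) radial \<Rightarrow> ('a, 'b) radial \<Rightarrow> ('a, 'b) radial" is "(*)"
proof -
  fix a a' b b' :: "'a word \<Rightarrow>\<^sub>0 'b"
  assume "radial_eq a a'" "radial_eq b b'"
  then have "1 * (a - a') * b + a' * (b - b') * 1 \<in> radial_ideal"
    unfolding radial_eq_def by (intro radial_ideal_add radial_ideal_mult)
  then show "radial_eq (a * b) (a' * b')"
    by (simp add: radial_eq_def algebra_simps)
qed

lemma radial_one_neq_zero: "\<not> radial_eq (0 :: 'a word \<Rightarrow>\<^sub>0 'b) 1"
proof
  assume "radial_eq (0 :: 'a word \<Rightarrow>\<^sub>0 'b) 1"
  then have "- 1 \<in> (radial_ideal :: ('a word \<Rightarrow>\<^sub>0 'b) set)" by (simp add: radial_eq_def)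
  moreover have id: "is_ring_hom (\<lambda>c::'b. c)" by (simp add: is_ring_hom_def)
  then have hom: "is_ring_hom (free_eval (\<lambda>c::'b. c) (\<lambda>v::'a. 0))"
    by (rule free_eval_hom) simp
  moreover have "comm (anticomm (0::'b) 0) 0 = 0" by (simp add: comm_def anticomm_def)
  ultimately have "free_eval (\<lambda>c::'b. c) (\<lambda>v::'a. 0) (- 1) = 0"
    using hom_radial_ideal[OF hom] free_eval_var[OF id] by metis
  moreover have "free_eval (\<lambda>c::'b. c) (\<lambda>v::'a. 0) (- 1) = - 1"
    using is_ring_hom_diff[OF hom, of 0 1] is_ring_hom_0[OF hom] hom by (simp add: is_ring_hom_def)
  ultimately show False by simp
qed

lemma radial_eqI: "f = g \<Longrightarrow> radial_eq f g"
  by (simp add: radial_eq_def radial_ideal.zero)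

instance
proof
  show "(0 :: ('a, 'b) radial) \<noteq> 1" by transfer (rule radial_one_neq_zero)
qed (transfer, rule radial_eqI, simp add: algebra_simps)+

end

lift_definition radial_var :: "'v \<Rightarrow> ('v, 'k::comm_ring_1) radial" is free_var .

lift_definition radial_const :: "'k \<Rightarrow> ('v, 'k::comm_ring_1) radial" is free_const .

lemma radial_const_hom: "is_ring_hom (radial_const :: 'k \<Rightarrow> ('v, 'k::comm_ring_1) radial)"
  unfolding is_ring_hom_def
  by (intro conjI allI; transfer; rule radial_eqI)
    (simp_all add: free_const_def single_add mult_single)

lemma radial_const_central: "radial_const c * a = a * radial_const c"
proof (transfer, rule radial_eqI)
  fix c :: 'b and a :: "'a word \<Rightarrow>\<^sub>0 'b"
  show "free_const c * a = a * free_const c"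
    by (induction a rule: poly_mapping_add_induct)
      (simp_all add: free_const_def mult_single distrib_left distrib_right mult.commute)
qed

lemma radial_relation:
  "comm (anticomm (radial_var u) (radial_var v)) (radial_var w) = (0 :: ('v, 'k::comm_ring_1) radial)"
  unfolding comm_def anticomm_def
proof transfer
  fix u v w :: 'v
  show "radial_eq ((free_var u * free_var v + free_var v * free_var u) * free_var w -
      free_var w * (free_var u * free_var v + free_var v * free_var u)) (0 :: 'v word \<Rightarrow>\<^sub>0 'k)"
    using radial_ideal.add_rel[OF radial_ideal.zero, of 1 u v w 1]
    by (simp add: radial_eq_def comm_def anticomm_def)
qed

lemma radial_induct [case_names var const add mult]:
  assumes "\<And>v. P (radial_var v)" "\<And>c. P (radial_const c)"
    "\<And>a b. P a \<Longrightarrow> P b \<Longrightarrow> P (a + b)" "\<And>a b. P a \<Longrightarrow> P b \<Longrightarrow> P (a * b)"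
  shows "P (z :: ('v, 'k::comm_ring_1) radial)"
proof -
  have w: "P (abs_radial (Poly_Mapping.single (Word l) c))" for l c
  proof (induction l)
    case Nil
    then show ?case using assms(2)[of c]
      by (simp add: radial_const.abs_eq free_const_def zero_word_def)
  next
    case (Cons v l)
    have "abs_radial (Poly_Mapping.single (Word (v # l)) c) =
        radial_var v * abs_radial (Poly_Mapping.single (Word l) c)"
      by (simp add: radial_var.abs_eq times_radial.abs_eq free_var_def mult_single plus_word_def)
    then show ?case using assms(1,4) Cons by simp
  qed
  have "P (abs_radial f)" for f
  proof (induction f rule: poly_mapping_add_induct)
    case zero
    show ?case using w[of "[]" 0] by simp
  next
    case (single u c)
    show ?case using w[of "letters u" c] by simp
  next
    case (add a b)
    then show ?case using assms(3) by (metis plus_radial.abs_eq)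
  qed
  then show ?thesis by (induction z rule: radial.abs_induct)
qed

instantiation radial :: (type, "{comm_ring_1, real_algebra_1}") real_algebra_1
begin

definition "scaleR c a = radial_const (of_real c) * (a :: ('a, 'b) radial)"

instance
proof
  fix a b :: real and x y :: "('a, 'b) radial"
  note h = radial_const_hom[unfolded is_ring_hom_def]
  show "a *\<^sub>R (x + y) = a *\<^sub>R x + a *\<^sub>R y" by (simp add: scaleR_radial_def distrib_left)
  show "(a + b) *\<^sub>R x = a *\<^sub>R x + b *\<^sub>R x" by (simp add: scaleR_radial_def distrib_right h)
  show "a *\<^sub>R b *\<^sub>R x = (a * b) *\<^sub>R x" by (simp add: scaleR_radial_def h mult.assoc)
  show "1 *\<^sub>R x = x" by (simp add: scaleR_radial_def h)
  show "a *\<^sub>R x * y = a *\<^sub>R (x * y)" by (simp add: scaleR_radial_def mult.assoc)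
  show "x * a *\<^sub>R y = a *\<^sub>R (x * y)"
    unfolding scaleR_radial_def
    by (simp only: mult.assoc[symmetric] radial_const_central[of "of_real a" x])
qed

end

text \<open>The universal property of \<open>'k \<otimes> R(S)\<close> over the reals: a pair of ring homomorphisms on \<open>'k\<close>
  and on \<open>R(S)\<close> which have commuting images and agree on the reals extends uniquely.
  (The ring \<open>('v, real) radial\<close> is generated by its constants and variables.)\<close>

lemma radial_base_change:
  fixes \<phi> :: "'k::{comm_ring_1, real_algebra_1} \<Rightarrow> 'c::ring_1"
    and h :: "('v, real) radial \<Rightarrow> 'c"
  assumes \<phi>: "is_ring_hom \<phi>" and h: "is_ring_hom h"
    and commute: "\<And>c a. \<phi> c * h a = h a * \<phi> c"
    and agree: "\<And>t. \<phi> (of_real t) = h (radial_const t)"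
  shows "\<exists>!F :: ('v, 'k) radial \<Rightarrow> 'c. is_ring_hom F \<and> (\<forall>c. F (radial_const c) = \<phi> c) \<and>
    (\<forall>v. F (radial_var v) = h (radial_var v))"
proof -
  let ?E = "free_eval \<phi> (\<lambda>v. h (radial_var v))"
  have E: "is_ring_hom ?E" by (rule free_eval_hom[OF \<phi> commute])
  have rel: "comm (anticomm (?E (free_var u)) (?E (free_var v))) (?E (free_var w)) = 0" for u v w
  proof -
    have "h (comm (anticomm (radial_var u) (radial_var v)) (radial_var w)) = 0"
      by (simp add: radial_relation is_ring_hom_0[OF h])
    then show ?thesis
      using h is_ring_hom_diff[OF h]
      by (simp add: free_eval_var[OF \<phi>] comm_def anticomm_def is_ring_hom_def)
  qed
  define F :: "('v, 'k) radial \<Rightarrow> 'c" where "F z = ?E (rep_radial z)" for z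
  have Fabs: "F (abs_radial f) = ?E f" for f
  proof -
    have "radial_eq (rep_radial (abs_radial f)) f"
      by (simp add: Quotient3_radial rep_abs_rsp_left radial_eqI)
    then have "?E (rep_radial (abs_radial f) - f) = 0"
      unfolding radial_eq_def by (rule hom_radial_ideal[OF E rel])
    then show ?thesis by (simp add: F_def is_ring_hom_diff[OF E])
  qed
  have hom: "is_ring_hom F"
    unfolding is_ring_hom_def
  proof (intro conjI allI)
    show "F 1 = 1" using E by (simp add: one_radial.abs_eq Fabs is_ring_hom_def)
    fix a b :: "('v, 'k) radial"
    obtain f g where ab: "a = abs_radial f" "b = abs_radial g"
      by (metis Quotient3_abs_rep Quotient3_radial)
    show "F (a + b) = F a + F b" using E by (simp add: ab plus_radial.abs_eq Fabs is_ring_hom_def)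
    show "F (a * b) = F a * F b" using E by (simp add: ab times_radial.abs_eq Fabs is_ring_hom_def)
  qed
  show ?thesis
  proof (rule ex1I[of _ F])
    show "is_ring_hom F \<and> (\<forall>c. F (radial_const c) = \<phi> c) \<and> (\<forall>v. F (radial_var v) = h (radial_var v))"
      by (simp add: hom radial_const.abs_eq radial_var.abs_eq Fabs free_eval_const[OF \<phi>] free_eval_var[OF \<phi>])
    fix G :: "('v, 'k) radial \<Rightarrow> 'c"
    assume G: "is_ring_hom G \<and> (\<forall>c. G (radial_const c) = \<phi> c) \<and> (\<forall>v. G (radial_var v) = h (radial_var v))"
    have "G z = F z" for z
      by (induction z rule: radial_induct)
        (use G hom in \<open>simp_all add: is_ring_hom_def radial_const.abs_eq radial_var.abs_eq Fabs
          free_eval_const[OF \<phi>] free_eval_var[OF \<phi>]\<close>)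
    then show "G = F" by blast
  qed
qed

definition wedge :: "'a::real_algebra_1 list \<Rightarrow> 'a" where
  "wedge us = (1 / fact (length us)) *\<^sub>R
     (\<Sum>\<pi> | \<pi> permutes {..<length us}.
        of_int (sign \<pi>) * prod_list (map (\<lambda>k. us ! \<pi> k) [0..<length us]))"

section \<open>The coefficient ring\<close>

text \<open>The subring \<open>\<real>[q, 1/q, Q, 1/(1-q)]\<close> of the field \<open>\<real>(q,Q)\<close>; the latter is represented as the
  fraction field of \<open>\<real>[q][Q]\<close>.\<close>

definition frac_real :: "real \<Rightarrow> real poly poly fract" where
  "frac_real c = Fract [:[:c:]:] 1"

definition frac_q :: "real poly poly fract" where
  "frac_q = Fract [:[:0, 1:]:] 1"

definition frac_Q :: "real poly poly fract" where
  "frac_Q = Fract [:0, 1:] 1"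

inductive_set bcoeff_set :: "real poly poly fract set" where
  real: "frac_real c \<in> bcoeff_set"
| q: "frac_q \<in> bcoeff_set"
| q_inv: "inverse frac_q \<in> bcoeff_set"
| Q: "frac_Q \<in> bcoeff_set"
| one_minus_q_inv: "inverse (1 - frac_q) \<in> bcoeff_set"
| add: "a \<in> bcoeff_set \<Longrightarrow> b \<in> bcoeff_set \<Longrightarrow> a + b \<in> bcoeff_set"
| mult: "a \<in> bcoeff_set \<Longrightarrow> b \<in> bcoeff_set \<Longrightarrow> a * b \<in> bcoeff_set"

lemma frac_real_simps:
  "frac_real 0 = 0" "frac_real 1 = 1" "frac_real (- c) = - frac_real c"
  "frac_real (c + d) = frac_real c + frac_real d" "frac_real (c * d) = frac_real c * frac_real d"
  by (simp_all add: frac_real_def Zero_fract_def One_fract_def flip: one_pCons)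

lemma bcoeff_set_0: "0 \<in> bcoeff_set" and bcoeff_set_1: "1 \<in> bcoeff_set"
  using bcoeff_set.real[of 0] bcoeff_set.real[of 1] by (simp_all add: frac_real_simps)

lemma bcoeff_set_uminus: "a \<in> bcoeff_set \<Longrightarrow> - a \<in> bcoeff_set"
  using bcoeff_set.mult[OF bcoeff_set.real[of "- 1"], of a] by (simp add: frac_real_simps)

lemma bcoeff_set_power: "a \<in> bcoeff_set \<Longrightarrow> a ^ n \<in> bcoeff_set"
  by (induction n) (simp_all add: bcoeff_set_1 bcoeff_set.mult)

typedef bcoeff = bcoeff_set
  using bcoeff_set_0 by blast

setup_lifting type_definition_bcoeff

instantiation bcoeff :: "{idom, real_algebra_1}"
begin

lift_definition zero_bcoeff :: bcoeff is 0 by (rule bcoeff_set_0)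
lift_definition one_bcoeff :: bcoeff is 1 by (rule bcoeff_set_1)
lift_definition plus_bcoeff :: "bcoeff \<Rightarrow> bcoeff \<Rightarrow> bcoeff" is "(+)" by (rule bcoeff_set.add)
lift_definition times_bcoeff :: "bcoeff \<Rightarrow> bcoeff \<Rightarrow> bcoeff" is "(*)" by (rule bcoeff_set.mult)
lift_definition uminus_bcoeff :: "bcoeff \<Rightarrow> bcoeff" is uminus by (rule bcoeff_set_uminus)
lift_definition minus_bcoeff :: "bcoeff \<Rightarrow> bcoeff \<Rightarrow> bcoeff" is "(-)"
  by (metis bcoeff_set.add bcoeff_set_uminus diff_conv_add_uminus)
lift_definition scaleR_bcoeff :: "real \<Rightarrow> bcoeff \<Rightarrow> bcoeff" is "\<lambda>c a. frac_real c * a"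
  by (intro bcoeff_set.mult bcoeff_set.real)

instance
  by standard (transfer, simp add: algebra_simps frac_real_simps)+

end

lift_definition q_B :: bcoeff is frac_q by (rule bcoeff_set.q)

lift_definition Q_B :: bcoeff is frac_Q by (rule bcoeff_set.Q)

lift_definition inv_one_minus_q :: bcoeff is "inverse (1 - frac_q)"
  by (rule bcoeff_set.one_minus_q_inv)

lift_definition q_powi :: "int \<Rightarrow> bcoeff" is "\<lambda>a. frac_q powi a"
  by (simp add: power_int_def bcoeff_set_power bcoeff_set.q bcoeff_set.q_inv)

text \<open>\<open>q\<^bsup>m+a\<^esup> = Q q\<^bsup>a\<^esup>\<close> and \<open>[m+a]\<^sub>q\<close>, with \<open>m\<close> a formal symbol.\<close>

definition q_pow_m :: "int \<Rightarrow> bcoeff" where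
  "q_pow_m a = Q_B * q_powi a"

definition q_num_m :: "int \<Rightarrow> bcoeff" where
  "q_num_m a = (1 - Q_B * q_powi a) * inv_one_minus_q"

section \<open>The scalar algebra and the Jackson operators\<close>

text \<open>Elements of the scalar algebra are treated as polynomials in \<open>r\<close>, \<open>s\<^sub>i\<close>, \<open>c\<^sub>i\<^sub>j\<close>;
  \<open>scalar_eval\<close> below is their value in the radial algebra.\<close>

datatype svar = R_var | S_var nat | C_var nat nat

type_synonym spoly = "(svar \<Rightarrow>\<^sub>0 nat) \<Rightarrow>\<^sub>0 bcoeff"

definition sconst :: "bcoeff \<Rightarrow> spoly" where
  "sconst c = Poly_Mapping.single 0 c"

definition svariable :: "svar \<Rightarrow> spoly" where
  "svariable u = Poly_Mapping.single (Poly_Mapping.single u 1) 1"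

definition svars :: "nat \<Rightarrow> svar set" where
  "svars N = {R_var} \<union> S_var ` {1..N} \<union> {C_var i j | i j. 1 \<le> i \<and> i \<le> j \<and> j \<le> N}"

definition scalar_algebra :: "nat \<Rightarrow> spoly set" where
  "scalar_algebra N = {A. \<forall>\<mu>\<in>Poly_Mapping.keys A. Poly_Mapping.keys \<mu> \<subseteq> svars N}"

definition q_shift :: "svar \<Rightarrow> bcoeff \<Rightarrow> spoly \<Rightarrow> spoly" where
  "q_shift u P A = (\<Sum>\<mu>\<in>Poly_Mapping.keys A.
     Poly_Mapping.single \<mu> (Poly_Mapping.lookup A \<mu> * P ^ Poly_Mapping.lookup \<mu> u))"

text \<open>The quotient \<open>(f(u) - f(Pu)) / ((1-P)u)\<close>, formed in the integral domain of polynomials.\<close>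

definition jackson :: "svar \<Rightarrow> bcoeff \<Rightarrow> spoly \<Rightarrow> spoly" where
  "jackson u P A = (THE G. sconst (1 - P) * svariable u * G = A - q_shift u P A)"

definition E_sc :: "nat \<Rightarrow> spoly \<Rightarrow> spoly" where
  "E_sc N A = sconst (1 + q_B) * svariable R_var * jackson R_var (q_B ^ 2) A
     + q_shift R_var (q_B ^ 2) (\<Sum>i=1..N. svariable (S_var i) * jackson (S_var i) q_B A)"

definition Delta :: "nat \<Rightarrow> nat \<Rightarrow> spoly \<Rightarrow> spoly" where
  "Delta N p A = (- 1) ^ p * (sconst (q_num_m (- int p)) * A + sconst (q_pow_m (- int p)) * E_sc N A)"

section \<open>The exterior splitting and the operators on the radial algebra\<close>

text \<open>Throughout, \<open>x :: 'v\<close> and \<open>y :: nat \<Rightarrow> 'v\<close> are the vector variables \<open>x\<close>, \<open>y\<^sub>1, \<dots>, y\<^sub>N\<close>; they are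
  meant to exhaust the type \<open>'v\<close>, so that \<open>('v, bcoeff) radial\<close> is the radial algebra on \<open>{x} \<union> Y\<close>.\<close>

type_synonym 'v rad = "('v, bcoeff) radial"

primrec svar_value :: "'v \<Rightarrow> (nat \<Rightarrow> 'v) \<Rightarrow> svar \<Rightarrow> 'v rad" where
  "svar_value x y R_var = radial_var x ^ 2"
| "svar_value x y (S_var i) = anticomm (radial_var x) (radial_var (y i))"
| "svar_value x y (C_var i j) = anticomm (radial_var (y i)) (radial_var (y j))"

text \<open>The product over a monomial is a fold since the radial algebra is not commutative; the order
  is irrelevant as all factors are central.\<close>

definition monomial_value :: "'v \<Rightarrow> (nat \<Rightarrow> 'v) \<Rightarrow> (svar \<Rightarrow>\<^sub>0 nat) \<Rightarrow> 'v rad" where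
  "monomial_value x y \<mu> =
     Finite_Set.fold (\<lambda>u z. svar_value x y u ^ Poly_Mapping.lookup \<mu> u * z) 1 (Poly_Mapping.keys \<mu>)"

definition scalar_eval :: "'v \<Rightarrow> (nat \<Rightarrow> 'v) \<Rightarrow> spoly \<Rightarrow> 'v rad" where
  "scalar_eval x y A =
     (\<Sum>\<mu>\<in>Poly_Mapping.keys A. radial_const (Poly_Mapping.lookup A \<mu>) * monomial_value x y \<mu>)"

definition y_wedge :: "(nat \<Rightarrow> 'v) \<Rightarrow> nat set \<Rightarrow> 'v rad" where
  "y_wedge y I = wedge (map (\<lambda>i. radial_var (y i)) (sorted_list_of_set I))"

definition xy_wedge :: "'v \<Rightarrow> (nat \<Rightarrow> 'v) \<Rightarrow> nat set \<Rightarrow> 'v rad" where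
  "xy_wedge x y I = wedge (radial_var x # map (\<lambda>i. radial_var (y i)) (sorted_list_of_set I))"

definition Y_space :: "'v \<Rightarrow> (nat \<Rightarrow> 'v) \<Rightarrow> nat \<Rightarrow> 'v rad set" where
  "Y_space x y N = {\<Sum>I\<in>Pow {1..N}. y_wedge y I * scalar_eval x y (A I) | A.
     \<forall>I. A I \<in> scalar_algebra N}"

definition X_space :: "'v \<Rightarrow> (nat \<Rightarrow> 'v) \<Rightarrow> nat \<Rightarrow> 'v rad set" where
  "X_space x y N = {\<Sum>I\<in>Pow {1..N}. xy_wedge x y I * scalar_eval x y (A I) | A.
     \<forall>I. A I \<in> scalar_algebra N}"

definition d_sc :: "'v \<Rightarrow> (nat \<Rightarrow> 'v) \<Rightarrow> nat \<Rightarrow> spoly \<Rightarrow> 'v rad" where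
  "d_sc x y N A =
     radial_const (1 + q_B) * radial_var x * scalar_eval x y (jackson R_var (q_B ^ 2) A)
     + 2 * (\<Sum>i=1..N. radial_var (y i) *
         scalar_eval x y (q_shift R_var (q_B ^ 2) (jackson (S_var i) q_B A)))"

text \<open>The operators below are specified by their values on the elements \<open>y\<^sub>I A\<close> and \<open>(x \<and> y\<^sub>I) A\<close>;
  these specifications have exactly one solution because the radial algebra is free over the
  scalar algebra on the elements \<open>y\<^sub>I\<close>, \<open>x \<and> y\<^sub>I\<close>.\<close>

definition d_R :: "'v \<Rightarrow> (nat \<Rightarrow> 'v) \<Rightarrow> nat \<Rightarrow> 'v rad \<Rightarrow> 'v rad" where
  "d_R x y N = (THE D.
     module_hom (\<lambda>c a. radial_const c * a) (\<lambda>c a. radial_const c * a) D \<and>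
     (\<forall>I A. I \<subseteq> {1..N} \<longrightarrow> A \<in> scalar_algebra N \<longrightarrow>
        D (y_wedge y I * scalar_eval x y A) = y_wedge y I * d_sc x y N A) \<and>
     (\<forall>I B. I \<subseteq> {1..N} \<longrightarrow> B \<in> scalar_algebra N \<longrightarrow>
        D (xy_wedge x y I * scalar_eval x y B) =
          (- 1) ^ card I * radial_const (q_num_m (- int (card I))) * y_wedge y I * scalar_eval x y B
          + radial_const (q_pow_m (- int (card I))) * xy_wedge x y I * d_sc x y N B))"

definition creation :: "'v \<Rightarrow> (nat \<Rightarrow> 'v) \<Rightarrow> nat \<Rightarrow> 'v rad \<Rightarrow> 'v rad" where
  "creation x y N = (THE C. additive C \<and>
     (\<forall>I A. I \<subseteq> {1..N} \<longrightarrow> A \<in> scalar_algebra N \<longrightarrow>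
        C (y_wedge y I * scalar_eval x y A) = xy_wedge x y I * scalar_eval x y A \<and>
        C (xy_wedge x y I * scalar_eval x y A) = 0))"

definition H_op :: "'v \<Rightarrow> (nat \<Rightarrow> 'v) \<Rightarrow> nat \<Rightarrow> 'v rad \<Rightarrow> 'v rad" where
  "H_op x y N z = d_R x y N (creation x y N z) + creation x y N (d_R x y N z)"

text \<open>Both operators denoted \<open>\<Oplus>\<^sub>I \<Delta>\<close>, as one operator on the whole radial algebra.\<close>

definition Delta_sum :: "'v \<Rightarrow> (nat \<Rightarrow> 'v) \<Rightarrow> nat \<Rightarrow> 'v rad \<Rightarrow> 'v rad" where
  "Delta_sum x y N = (THE D. additive D \<and>
     (\<forall>I A. I \<subseteq> {1..N} \<longrightarrow> A \<in> scalar_algebra N \<longrightarrow>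
        D (y_wedge y I * scalar_eval x y A) = y_wedge y I * scalar_eval x y (Delta N (card I) A) \<and>
        D (xy_wedge x y I * scalar_eval x y A) = xy_wedge x y I * scalar_eval x y (Delta N (card I) A)))"

definition N_part :: "'v \<Rightarrow> (nat \<Rightarrow> 'v) \<Rightarrow> nat \<Rightarrow> nat set \<Rightarrow> spoly \<Rightarrow> 'v rad" where
  "N_part x y N I A =
     radial_const (q_pow_m (- int (card I))) * xy_wedge x y I * d_sc x y N A
     + creation x y N (y_wedge y I * d_sc x y N A)
     - (- 1) ^ card I * radial_const (q_pow_m (- int (card I))) * y_wedge y I
         * scalar_eval x y (E_sc N A)"

definition N_op :: "'v \<Rightarrow> (nat \<Rightarrow> 'v) \<Rightarrow> nat \<Rightarrow> 'v rad \<Rightarrow> 'v rad" where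
  "N_op x y N = (THE F. F \<in> Y_space x y N \<rightarrow>\<^sub>E X_space x y N \<and>
     (\<forall>u\<in>Y_space x y N. \<forall>w\<in>Y_space x y N. F (u + w) = F u + F w) \<and>
     (\<forall>I A. I \<subseteq> {1..N} \<longrightarrow> A \<in> scalar_algebra N \<longrightarrow>
        F (y_wedge y I * scalar_eval x y A) = N_part x y N I A))"

text \<open>\<open>F\<close> has the block matrix with rows \<open>(a, b)\<close>, \<open>(c, d)\<close> with respect to the internal direct sum
  decomposition into \<open>U\<close> and \<open>W\<close>.\<close>

definition has_block_matrix ::
  "'a::ab_group_add set \<Rightarrow> 'a set \<Rightarrow> ('a \<Rightarrow> 'a) \<Rightarrow> ('a \<Rightarrow> 'a) \<Rightarrow> ('a \<Rightarrow> 'a) \<Rightarrow> ('a \<Rightarrow> 'a) \<Rightarrow> ('a \<Rightarrow> 'a) \<Rightarrow> bool"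
where
  "has_block_matrix U W F a b c d \<longleftrightarrow>
     (\<forall>z. \<exists>!p. fst p \<in> U \<and> snd p \<in> W \<and> z = fst p + snd p) \<and>
     a \<in> U \<rightarrow> U \<and> b \<in> W \<rightarrow> U \<and> c \<in> U \<rightarrow> W \<and> d \<in> W \<rightarrow> W \<and>
     (\<forall>u\<in>U. \<forall>w\<in>W. F (u + w) = (a u + b w) + (c u + d w))"

end

theory Submission
  imports Defs "HOL-Library.Function_Algebras" "Jordan_Normal_Form.Determinant"
begin

text \<open>Right multiplication by a vector \<open>v\<close> sends \<open>u\<^sub>1 \<and> \<dots> \<and> u\<^sub>k\<close> to \<open>u\<^sub>1 \<and> \<dots> \<and> u\<^sub>k \<and> v\<close> plus contractions with
  coefficients \<open>\<plusminus>{u\<^sub>j, v}/2\<close>. Hence the elements \<open>y\<^sub>I\<close>, \<open>x \<and> y\<^sub>I\<close> span the radial algebra over its scalars. They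
  are independent because the radial algebra acts on the free exterior module over the scalar polynomials,
  a vector acting as the sum of a creation operator and a combination of annihilation operators, and
  the wedge of basis vectors sends the vacuum to the corresponding basis element. So every operator given by
  its values on the basis exists and is unique. The same multiplication formula shows that the component of
  \<open>(x \<and> y\<^sub>I) \<partial>\<^sup>s\<^sup>c A\<close> without \<open>x\<close> is \<open>(-1)\<^sup>p y\<^sub>I E\<^sup>s\<^sup>c A\<close>, which gives the diagonal of \<open>\<H>\<close> and places the
  remainder \<open>\<N>\<close> in \<open>\<X>\<close>.\<close>

section \<open>Multiplying a wedge by a vector\<close>

text \<open>The operators are definite descriptions, so nothing can be said about their values
  before freeness is proved; and since the radial algebra is a quotient by an ideal, independence
  can only be seen on a concrete module. The wedge is a permutation sum, not a recursive product, so
  the multiplication formula has to come from expanding permutation sums by the image or preimage of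
  one slot. The constants of \<Delta> come from a single contraction. In x \<and> y_I the vector x
  stands first, with p vectors to its right, so contracting it costs the sign (-1)^p. Contracting x
  with y_i gives s_i/2, whose 1/2 cancels the 2 in the scalar derivative; contracting x with x gives
  r, which meets the factor 1+q. Together these form E^sc, and every other term keeps x.\<close>

definition alt_sum :: "('b list \<Rightarrow> 'a::ring_1) \<Rightarrow> 'b list \<Rightarrow> 'a" where
  "alt_sum F us = (\<Sum>\<pi> | \<pi> permutes {..<length us}. of_int (sign \<pi>) * F (permute_list \<pi> us))"

definition insert_at :: "nat \<Rightarrow> 'b \<Rightarrow> 'b list \<Rightarrow> 'b list" where
  "insert_at j v l = take j l @ v # drop j l"

definition delete_at :: "nat \<Rightarrow> 'b list \<Rightarrow> 'b list" where
  "delete_at i us = take i us @ drop (Suc i) us"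

text \<open>The product is generalised to an arbitrary list functional because expanding the
  permutation sum leads to functionals such as inserting a vector at slot \<open>j\<close> and then
  multiplying.\<close>

lemma wedge_alt_sum: "wedge us = (1 / fact (length us)) *\<^sub>R alt_sum prod_list us"
  unfolding wedge_def alt_sum_def permute_list_def ..

lemma length_delete_at: "i < length us \<Longrightarrow> length (delete_at i us) = length us - 1"
  by (simp add: delete_at_def)

lemma alt_sum_cong:
  assumes "\<And>l. mset l = mset us \<Longrightarrow> F l = G l"
  shows "alt_sum F us = alt_sum G us"
  unfolding alt_sum_def
  by (intro sum.cong refl arg_cong2[of _ _ _ _ "(*)"] assms) simp

lemma alt_sum_add: "alt_sum (\<lambda>l. F l + G l) us = alt_sum F us + alt_sum G us"
  by (simp add: alt_sum_def distrib_left sum.distrib)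

lemma of_int_commute: "of_int k * a = a * (of_int k :: 'a::ring_1)"
  by (induction k) (simp_all add: algebra_simps flip: mult_of_nat_commute)

lemma minus_one_power_commute: "(- 1) ^ k * a = a * ((- 1) ^ k :: 'a::ring_1)"
  by (induction k) simp_all

lemma alt_sum_mult_left: "alt_sum (\<lambda>l. c * F l) us = c * alt_sum F us"
  by (simp add: alt_sum_def sum_distrib_left of_int_commute mult.assoc)

text \<open>Permutations of n+1 slots sending \<open>j\<close> to \<open>i\<close> arise from
  permutations of n slots by skipping \<open>j\<close> in the source and \<open>i\<close> in the
  target. On lists: delete entry \<open>i\<close>, permute the rest, put the entry back at slot
  \<open>j\<close>.\<close>

lemma permute_list_permutation_insert:
  assumes q: "q permutes {..<n}" and us: "length us = Suc n" and i: "i < Suc n" and j: "j < Suc n"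
  shows "permute_list (permutation_insert j i q) us = insert_at j (us ! i) (permute_list q (delete_at i us))"
proof (rule nth_equalityI)
  have l: "length (delete_at i us) = n" using us i by (simp add: length_delete_at)
  show "length (permute_list (permutation_insert j i q) us)
      = length (insert_at j (us ! i) (permute_list q (delete_at i us)))"
    using l us j by (simp add: insert_at_def)
  fix k assume "k < length (permute_list (permutation_insert j i q) us)"
  then have k: "k < Suc n" using us by simp
  have q': "q a < n" if "a < n" for a using permutes_in_image[OF q, of a] that by simp
  have nd: "delete_at i us ! a = us ! (if a < i then a else Suc a)" if "a < n" for a
    using that i us by (auto simp: delete_at_def nth_append)
  have np: "permute_list q (delete_at i us) ! a = us ! (if q a < i then q a else Suc (q a))" if "a < n" for a
    using that q' l by (simp add: permute_list_def nd)
  have "insert_at j (us ! i) (permute_list q (delete_at i us)) ! k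
      = (if k < j then permute_list q (delete_at i us) ! k
         else if k = j then us ! i else permute_list q (delete_at i us) ! (k - 1))"
    using k j l by (cases "k - j") (auto simp: insert_at_def nth_append min_def intro!: arg_cong2[of _ _ _ _ nth])
  moreover have "permute_list (permutation_insert j i q) us ! k = us ! permutation_insert j i q k"
    using k us by (simp add: permute_list_def del: upt_Suc)
  ultimately show "permute_list (permutation_insert j i q) us ! k
      = insert_at j (us ! i) (permute_list q (delete_at i us)) ! k"
    using k j np[of k] np[of "k - 1"] unfolding permutation_insert_expand by (auto simp: not_less)
qed

text \<open>A Laplace cofactor, with a list functional in place of a product of matrix entries. The
  sign is that of \<open>permutation_insert\<close> relative to the smaller permutation.\<close>

lemma alt_sum_restrict:
  assumes us: "length us = Suc n" and i: "i < Suc n" and j: "j < Suc n"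
  shows "(\<Sum>\<pi> | \<pi> permutes {..<Suc n} \<and> \<pi> j = i. of_int (sign \<pi>) * F (permute_list \<pi> us))
    = (- 1) ^ (i + j) * alt_sum (\<lambda>l. F (insert_at j (us ! i) l)) (delete_at i us)"
proof -
  have l: "length (delete_at i us) = n" using us i by (simp add: length_delete_at)
  have "{\<pi>. \<pi> permutes {..<Suc n} \<and> \<pi> j = i} = permutation_insert j i ` {q. q permutes {..<n}}"
    using permutation_fix[OF j i] by (simp add: atLeast0LessThan)
  moreover have "inj_on (permutation_insert j i) {q. q permutes {..<n}}"
    using permutation_insert_inj_on[OF j i] by (simp add: atLeast0LessThan)
  ultimately have "(\<Sum>\<pi> | \<pi> permutes {..<Suc n} \<and> \<pi> j = i. of_int (sign \<pi>) * F (permute_list \<pi> us))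
      = (\<Sum>q | q permutes {..<n}. of_int (sign (permutation_insert j i q)) * F (permute_list (permutation_insert j i q) us))"
    by (simp add: sum.reindex)
  also have "\<dots> = (\<Sum>q | q permutes {..<n}. (- 1) ^ (i + j) * (of_int (sign q) * F (insert_at j (us ! i) (permute_list q (delete_at i us)))))"
  proof (rule sum.cong[OF refl], clarify)
    fix q assume q: "q permutes {..<n}"
    then have "(of_int (sign (permutation_insert j i q)) :: 'b) = (- 1) ^ (j + i) * of_int (sign q)"
      using signof_permutation_insert[OF _ j i, of q] by (simp add: atLeast0LessThan)
    then show "of_int (sign (permutation_insert j i q)) * F (permute_list (permutation_insert j i q) us) =
        (- 1) ^ (i + j) * (of_int (sign q) * F (insert_at j (us ! i) (permute_list q (delete_at i us))))"
      by (simp add: permute_list_permutation_insert[OF q us i j] mult.assoc add.commute)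
  qed
  finally show ?thesis by (simp add: alt_sum_def l sum_distrib_left)
qed

text \<open>Groups the permutations by the entry that lands in a fixed slot. It serves the
  anticommutator terms, where the slot next to the moving vector is fixed.\<close>

lemma alt_sum_expand_position:
  assumes us: "length us = Suc n" and j: "j < Suc n"
  shows "alt_sum F us = (\<Sum>i<Suc n. (- 1) ^ (i + j) * alt_sum (\<lambda>l. F (insert_at j (us ! i) l)) (delete_at i us))"
proof -
  have "alt_sum F us = (\<Sum>i<Suc n. \<Sum>\<pi> | \<pi> \<in> {\<pi>. \<pi> permutes {..<Suc n}} \<and> \<pi> j = i. of_int (sign \<pi>) * F (permute_list \<pi> us))"
    unfolding alt_sum_def us
  proof (rule sum.group[symmetric])
    show "(\<lambda>\<pi>. \<pi> j) ` {\<pi>. \<pi> permutes {..<Suc n}} \<subseteq> {..<Suc n}"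
      using permutes_in_image[of _ "{..<Suc n}" j] j by auto
  qed (simp_all add: finite_permutations)
  then show ?thesis using alt_sum_restrict[OF us _ j, of _ F] by simp
qed

text \<open>Groups the permutations by the slot that a fixed entry reaches. Applied to
  \<open>us @ [v]\<close> it sums over all positions of \<open>v\<close>.\<close>

lemma alt_sum_expand_entry:
  assumes us: "length us = Suc n" and i: "i < Suc n"
  shows "alt_sum F us = (\<Sum>j<Suc n. (- 1) ^ (i + j) * alt_sum (\<lambda>l. F (insert_at j (us ! i) l)) (delete_at i us))"
proof -
  have *: "inv_into UNIV \<pi> i = j \<longleftrightarrow> \<pi> j = i" if "\<pi> permutes {..<Suc n}" for \<pi> j
    using permutes_inv_eq[OF that] by auto
  have "alt_sum F us = (\<Sum>j<Suc n. \<Sum>\<pi> | \<pi> \<in> {\<pi>. \<pi> permutes {..<Suc n}} \<and> inv_into UNIV \<pi> i = j. of_int (sign \<pi>) * F (permute_list \<pi> us))"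
    unfolding alt_sum_def us
  proof (rule sum.group[symmetric])
    show "(\<lambda>\<pi>. inv_into UNIV \<pi> i) ` {\<pi>. \<pi> permutes {..<Suc n}} \<subseteq> {..<Suc n}"
      using permutes_in_image[OF permutes_inv, of _ "{..<Suc n}" i] i by auto
  qed (simp_all add: finite_permutations)
  also have "\<dots> = (\<Sum>j<Suc n. \<Sum>\<pi> | \<pi> permutes {..<Suc n} \<and> \<pi> j = i. of_int (sign \<pi>) * F (permute_list \<pi> us))"
    by (intro sum.cong) (auto simp: *)
  finally show ?thesis using alt_sum_restrict[OF us i, of _ F] by simp
qed

lemma prod_list_insert_at:
  assumes "j < length l"
  shows "prod_list (insert_at j v l) + prod_list (insert_at (Suc j) v l)
    = prod_list (take j l) * anticomm v (l ! j) * prod_list (drop (Suc j) l)"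
proof -
  have "drop j l = l ! j # drop (Suc j) l" "take (Suc j) l = take j l @ [l ! j]"
    using assms by (simp_all add: Cons_nth_drop_Suc take_Suc_conv_app_nth)
  then show ?thesis
    by (simp add: insert_at_def anticomm_def algebra_simps)
qed

text \<open>Moving \<open>v\<close> past one factor costs an anticommutator, and the alternating sum of these costs does
  not depend on the position up to sign; averaging over the positions of \<open>v\<close> gives the factor \<open>1/2\<close>.\<close>

lemma wedge_mult_vector:
  fixes v :: "'a::real_algebra_1"
  assumes central: "\<And>u a. u \<in> set us \<Longrightarrow> anticomm v u * a = a * anticomm v u"
  shows "wedge us * v = wedge (us @ [v]) +
    (\<Sum>i<length us. (- 1) ^ (length us + Suc i) * ((1 / 2) *\<^sub>R anticomm v (us ! i)) * wedge (delete_at i us))"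
proof (cases us)
  case Nil
  then show ?thesis by (simp add: wedge_alt_sum alt_sum_def lessThan_Suc sign_id permute_list_def)
next
  case (Cons u0 us0)
  define k where "k = length us0"
  have us: "length us = Suc k" by (simp add: Cons k_def)
  \<comment> \<open>\<open>T j\<close> alternates the vectors of \<open>us\<close> with
    \<open>v\<close> held at slot \<open>j\<close>, so \<open>T (Suc k)\<close> has \<open>v\<close>
    as right factor. \<open>S\<close> collects the contractions, up to normalisation.\<close>
  define T where "T j = alt_sum (\<lambda>l. prod_list (insert_at j v l)) us" for j
  define S where "S = (\<Sum>i<Suc k. (- 1) ^ i * anticomm v (us ! i) * alt_sum prod_list (delete_at i us))"
  have step: "T j + T (Suc j) = (- 1) ^ j * S" if j: "j < Suc k" for j
  proof -
    have "T j + T (Suc j) = alt_sum (\<lambda>l. prod_list (take j l) * anticomm v (l ! j) * prod_list (drop (Suc j) l)) us"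
      unfolding T_def alt_sum_add[symmetric]
      by (rule alt_sum_cong) (use j us in \<open>auto intro!: prod_list_insert_at dest!: mset_eq_length\<close>)
    \<comment> \<open>Expanding along the very slot \<open>j\<close> fixes the entry that
      \<open>v\<close> passes. Its anticommutator with \<open>v\<close> is central, so it leaves the
      alternating sum, and what remains depends on \<open>j\<close> only through the sign.\<close>
    also have "\<dots> = (\<Sum>i<Suc k. (- 1) ^ (i + j) * alt_sum (\<lambda>l. (\<lambda>l. prod_list (take j l) * anticomm v (l ! j)
        * prod_list (drop (Suc j) l)) (insert_at j (us ! i) l)) (delete_at i us))"
      by (rule alt_sum_expand_position[OF us j])
    also have "\<dots> = (\<Sum>i<Suc k. (- 1) ^ (i + j) * (anticomm v (us ! i) * alt_sum prod_list (delete_at i us)))"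
    proof (intro sum.cong refl arg_cong2[of _ _ _ _ "(*)"])
      fix i assume "i \<in> {..<Suc k}"
      then have i: "i < length us" by (simp add: us)
      then have c: "anticomm v (us ! i) * a = a * anticomm v (us ! i)" for a
        by (intro central) simp
      have "alt_sum (\<lambda>l. (\<lambda>l. prod_list (take j l) * anticomm v (l ! j)
          * prod_list (drop (Suc j) l)) (insert_at j (us ! i) l)) (delete_at i us)
        = alt_sum (\<lambda>l. anticomm v (us ! i) * prod_list l) (delete_at i us)"
      proof (rule alt_sum_cong)
        fix l assume "mset l = mset (delete_at i us)"
        then have "length l = k" using i us by (metis length_delete_at mset_eq_length diff_Suc_1)
        then have m: "min (length l) j = j" "min j (length l) = j" using j by auto
        have "prod_list (take j l) * prod_list (drop j l) = prod_list l"
          by (simp flip: prod_list.append)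
        then show "(\<lambda>l. prod_list (take j l) * anticomm v (l ! j) * prod_list (drop (Suc j) l))
            (insert_at j (us ! i) l) = anticomm v (us ! i) * prod_list l"
          by (simp add: insert_at_def nth_append m flip: c) (simp add: mult.assoc m)
      qed
      then show "alt_sum (\<lambda>l. (\<lambda>l. prod_list (take j l) * anticomm v (l ! j)
          * prod_list (drop (Suc j) l)) (insert_at j (us ! i) l)) (delete_at i us)
        = anticomm v (us ! i) * alt_sum prod_list (delete_at i us)"
        by (simp add: alt_sum_mult_left)
    qed
    also have "\<dots> = (- 1) ^ j * S"
      unfolding S_def sum_distrib_left
      by (intro sum.cong) (simp_all add: power_add mult.assoc add.commute[of _ j])
    finally show ?thesis .
  qed
  \<comment> \<open>The relation \<open>step\<close> telescopes: going down from the last slot, each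
    move of \<open>v\<close> across one factor adds one copy of \<open>S\<close> to
    \<open>(- 1) ^ j * T j\<close>.\<close>
  have T: "(- 1) ^ j * T j = (- 1) ^ Suc k * T (Suc k) + of_nat (Suc k - j) * S" if "j \<le> Suc k" for j
    using that
  proof (induction rule: inc_induct)
    case (step n)
    have "(- 1) ^ n * T n = (- 1) ^ n * ((- 1) ^ n * S - T (Suc n))"
      using \<open>n < Suc k\<close> assms(1) by (simp add: algebra_simps flip: \<open>\<And>j. j < Suc k \<Longrightarrow> T j + T (Suc j) = (- 1) ^ j * S\<close>)
    also have "\<dots> = S + (- 1) ^ Suc n * T (Suc n)"
      by (simp add: right_diff_distrib flip: mult.assoc power_add)
    also have "\<dots> = (- 1) ^ Suc k * T (Suc k) + of_nat (Suc (Suc k - Suc n)) * S"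
      by (simp only: step.IH) (simp add: algebra_simps)
    finally show ?case using step.hyps by (simp add: Suc_diff_le)
  qed simp
  have Tk: "T (Suc k) = alt_sum prod_list us * v"
  proof -
    have "T (Suc k) = alt_sum (\<lambda>l. prod_list l * v) us"
      unfolding T_def by (rule alt_sum_cong) (auto simp: insert_at_def us dest!: mset_eq_length)
    then show ?thesis by (simp add: alt_sum_def sum_distrib_right mult.assoc)
  qed
  \<comment> \<open>Here \<open>Suc k\<close> is both the index of \<open>v\<close> in
    \<open>us @ [v]\<close> and its last possible slot; \<open>T (Suc k)\<close> is thus counted
    once for each of the k+2 slots.\<close>
  have "alt_sum prod_list (us @ [v]) = (\<Sum>j<Suc (Suc k). (- 1) ^ (Suc k + j) * T j)"
    using alt_sum_expand_entry[of "us @ [v]" "Suc k" "Suc k" prod_list] us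
    by (simp add: T_def nth_append delete_at_def del: sum.lessThan_Suc)
  also have "\<dots> = (\<Sum>j<Suc (Suc k). T (Suc k) + (- 1) ^ Suc k * (of_nat (Suc k - j) * S))"
  proof (rule sum.cong[OF refl])
    fix j assume "j \<in> {..<Suc (Suc k)}"
    then have "(- 1) ^ (Suc k + j) * T j = (- 1) ^ Suc k * ((- 1) ^ Suc k * T (Suc k) + of_nat (Suc k - j) * S)"
      using T[of j] by (simp only: power_add mult.assoc) simp
    moreover have "(- 1) ^ Suc k * ((- 1) ^ Suc k * a) = a" for a :: 'a
      by (simp flip: mult.assoc power_add)
    ultimately show "(- 1) ^ (Suc k + j) * T j = T (Suc k) + (- 1) ^ Suc k * (of_nat (Suc k - j) * S)"
      by (simp only: distrib_left)
  qed
  also have "\<dots> = of_nat (Suc (Suc k)) * T (Suc k) + (- 1) ^ Suc k * (of_nat (\<Sum>j<Suc (Suc k). Suc k - j) * S)"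
    by (simp only: sum.distrib sum_constant card_lessThan sum_distrib_left[symmetric] sum_distrib_right[symmetric] of_nat_sum)
  also have "(\<Sum>j<Suc (Suc k). Suc k - j) = (\<Sum>j<Suc (Suc k). j)"
    using sum.nat_diff_reindex[of "\<lambda>j. j" "Suc (Suc k)"] by simp
  finally have "alt_sum prod_list (us @ [v]) = of_nat (Suc (Suc k)) * T (Suc k)
      + (- 1) ^ Suc k * (of_nat (\<Sum>j<Suc (Suc k). j) * S)" .
  moreover have "2 * (\<Sum>j<Suc (Suc k). j) = Suc (Suc k) * Suc k"
    by (induction k) simp_all
  then have g: "real (\<Sum>j<Suc (Suc k). j) = real (Suc (Suc k)) * real (Suc k) / 2"
    by (metis nonzero_mult_div_cancel_left of_nat_mult of_nat_numeral zero_neq_numeral)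
  have sc: "of_nat n * a = real n *\<^sub>R (a::'a)" for n a
    by (simp add: scaleR_conv_of_real)
  have "alt_sum prod_list (us @ [v]) = real (Suc (Suc k)) *\<^sub>R (alt_sum prod_list us * v)
      + (real (Suc (Suc k)) * real (Suc k) / 2) *\<^sub>R ((- 1) ^ Suc k * S)"
    using calculation unfolding sc g Tk by simp
  \<comment> \<open>Division by (k+2)! turns the triangular number (k+2)(k+1)/2 into 1/(2 k!). The
    1/k! normalises the wedges of the \<open>k\<close> remaining vectors, and the 1/2 survives as
    coefficient of the anticommutator.\<close>
  then have "wedge (us @ [v]) = wedge us * v + ((1 / 2) / fact k) *\<^sub>R ((- 1) ^ Suc k * S)"
    by (simp add: wedge_alt_sum us scaleR_add_right field_simps del: of_nat_Suc power_Suc)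
  moreover have "((1 / 2) / fact k) *\<^sub>R ((- 1) ^ Suc k * S) = - (\<Sum>i<length us. (- 1) ^ (length us + Suc i) *
      ((1 / 2) *\<^sub>R anticomm v (us ! i)) * wedge (delete_at i us))"
    unfolding S_def us sum_distrib_left scaleR_sum_right sum_negf[symmetric]
    by (intro sum.cong) (simp_all add: wedge_alt_sum length_delete_at us power_add mult.assoc)
  ultimately show ?thesis by simp
qed

section \<open>Antisymmetry of the wedge\<close>

lemma alt_sum_permute_list:
  assumes \<sigma>: "\<sigma> permutes {..<length us}"
  shows "alt_sum F (permute_list \<sigma> us) = of_int (sign \<sigma>) * alt_sum F us"
proof -
  let ?S = "{\<pi>. \<pi> permutes {..<length us}}"
  have perm: "permutation \<pi>" if "\<pi> permutes {..<length us}" for \<pi>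
    using that permutation_permutes by blast
  have s: "sign \<sigma> * sign \<sigma> = 1" by (simp add: sign_def)
  have "of_int (sign \<sigma>) * alt_sum F us
      = of_int (sign \<sigma>) * (\<Sum>\<pi>\<in>?S. of_int (sign (\<sigma> \<circ> \<pi>)) * F (permute_list (\<sigma> \<circ> \<pi>) us))"
    unfolding alt_sum_def by (subst setum_permutations_compose_left[OF \<sigma>]) (rule refl)
  also have "\<dots> = (\<Sum>\<pi>\<in>?S. of_int (sign \<pi>) * F (permute_list \<pi> (permute_list \<sigma> us)))"
    unfolding sum_distrib_left
  proof (rule sum.cong[OF refl], clarify)
    fix \<pi> assume \<pi>: "\<pi> permutes {..<length us}"
    have "sign \<sigma> * sign (\<sigma> \<circ> \<pi>) = sign \<pi>"
      using s by (simp add: sign_compose[OF perm[OF \<sigma>] perm[OF \<pi>]] flip: mult.assoc)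
    then have "of_int (sign \<sigma>) * (of_int (sign (\<sigma> \<circ> \<pi>)) * a) = (of_int (sign \<pi>) * a :: 'b)" for a
      by (simp flip: mult.assoc of_int_mult)
    then show "of_int (sign \<sigma>) * (of_int (sign (\<sigma> \<circ> \<pi>)) * F (permute_list (\<sigma> \<circ> \<pi>) us)) =
        of_int (sign \<pi>) * F (permute_list \<pi> (permute_list \<sigma> us))"
      by (simp add: permute_list_compose[OF \<pi>])
  qed
  finally show ?thesis by (simp add: alt_sum_def)
qed

text \<open>The sign is left open because reordered wedges are only asked to lie in sets closed
  under negation. Where the exact coefficient matters, the list is already sorted.\<close>

lemma wedge_mset_eq:
  assumes "mset us = mset vs"
  shows "wedge us = wedge vs \<or> wedge us = - wedge vs"
proof -
  obtain \<sigma> where \<sigma>: "\<sigma> permutes {..<length vs}" "permute_list \<sigma> vs = us"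
    by (rule mset_eq_permutation[OF assms])
  have "wedge us = of_int (sign \<sigma>) * wedge vs"
    using alt_sum_permute_list[OF \<sigma>(1), of prod_list] mset_eq_length[OF assms]
    by (simp add: wedge_alt_sum \<sigma>(2))
  then show ?thesis by (auto simp: sign_def)
qed

text \<open>Transposing two equal entries fixes the list but flips the sign, and 2 is invertible
  over the reals.\<close>

lemma wedge_not_distinct:
  fixes us :: "'a::real_algebra_1 list"
  assumes "\<not> distinct us"
  shows "wedge us = 0"
proof -
  obtain i j where ij: "i < length us" "j < length us" "i \<noteq> j" "us ! i = us ! j"
    using assms by (auto simp: distinct_conv_nth)
  have p: "transpose i j permutes {..<length us}"
    using ij by (intro permutes_swap_id) auto
  have "permute_list (transpose i j) us = us"
    using ij by (intro nth_equalityI) (auto simp: permute_list_def transpose_def)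
  then have "alt_sum prod_list us = - alt_sum prod_list us"
    using alt_sum_permute_list[OF p, of prod_list] ij by (simp add: sign_swap_id)
  then have "2 *\<^sub>R alt_sum prod_list us = 0"
    by (metis add.right_inverse scaleR_2)
  then show ?thesis by (simp add: wedge_alt_sum)
qed

section \<open>Scalar polynomials and their evaluation\<close>

lemma lookup_sconst_mult: "Poly_Mapping.lookup (sconst c * A) \<mu> = c * Poly_Mapping.lookup A \<mu>"
  by (induction A rule: poly_mapping_add_induct)
    (simp_all add: sconst_def mult_single lookup_single when_def distrib_left lookup_add)

lemma lookup_svariable_mult_Suc:
  "Poly_Mapping.lookup (svariable u * A) (Poly_Mapping.single u 1 + \<nu>) = Poly_Mapping.lookup A \<nu>"
  by (induction A rule: poly_mapping_add_induct)
    (simp_all add: svariable_def mult_single lookup_single when_def distrib_left lookup_add)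

lemma lookup_svariable_mult_0:
  "Poly_Mapping.lookup \<mu> u = 0 \<Longrightarrow> Poly_Mapping.lookup (svariable u * A) \<mu> = 0"
  by (induction A rule: poly_mapping_add_induct)
    (auto simp: svariable_def mult_single lookup_single when_def distrib_left lookup_add)

text \<open>Together with the two lookup rules above this determines a product with a variable
  coefficientwise: exponents without \<open>u\<close> get 0, the others are shifted down by
  one.\<close>

lemma exponent_cases:
  fixes \<mu> :: "'a \<Rightarrow>\<^sub>0 nat"
  obtains "Poly_Mapping.lookup \<mu> u = 0" | \<nu> where "\<mu> = Poly_Mapping.single u 1 + \<nu>"
proof (cases "Poly_Mapping.lookup \<mu> u = 0")
  case False
  then have "\<mu> = Poly_Mapping.single u 1 + (\<mu> - Poly_Mapping.single u 1)"
    by (intro poly_mapping_eqI) (auto simp: lookup_add lookup_minus lookup_single when_def)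
  then show thesis by (rule that(2))
qed (rule that(1))

lemma lookup_q_shift:
  "Poly_Mapping.lookup (q_shift u P A) \<mu> = Poly_Mapping.lookup A \<mu> * P ^ Poly_Mapping.lookup \<mu> u"
  by (simp add: q_shift_def lookup_sum lookup_single when_def sum.delta in_keys_iff)

lemma q_shift_add: "q_shift u P (A + B) = q_shift u P A + q_shift u P B"
  by (rule poly_mapping_eqI) (simp add: lookup_q_shift lookup_add distrib_right)

lemma q_shift_sconst: "q_shift u P (sconst c * A) = sconst c * q_shift u P A"
  by (rule poly_mapping_eqI) (simp add: lookup_q_shift lookup_sconst_mult mult.assoc)

lemma q_shift_single: "q_shift u P (Poly_Mapping.single \<mu> c)
    = Poly_Mapping.single \<mu> (c * P ^ Poly_Mapping.lookup \<mu> u)"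
  by (rule poly_mapping_eqI) (simp add: lookup_q_shift lookup_single when_def)

lemma q_shift_svariable:
  assumes "w \<noteq> u"
  shows "q_shift u P (svariable w * A) = svariable w * q_shift u P A"
proof (rule poly_mapping_eqI)
  fix \<mu>
  show "Poly_Mapping.lookup (q_shift u P (svariable w * A)) \<mu> = Poly_Mapping.lookup (svariable w * q_shift u P A) \<mu>"
  proof (cases \<mu> w rule: exponent_cases)
    case 1
    then show ?thesis by (simp add: lookup_q_shift lookup_svariable_mult_0)
  next
    case (2 \<nu>)
    then show ?thesis using assms
      by (simp only: lookup_q_shift lookup_svariable_mult_Suc) (simp add: lookup_add lookup_single when_def)
  qed
qed

lemma q_shift_0: "q_shift u P 0 = 0"
  by (simp add: q_shift_def)

lemma q_shift_sum: "q_shift u P (sum f K) = (\<Sum>i\<in>K. q_shift u P (f i))"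
  by (induction K rule: infinite_finite_induct) (simp_all add: q_shift_0 q_shift_add)

text \<open>Multiplication by \<open>u\<close> only shifts exponents, so \<open>u\<close> cancels by
  comparing coefficients at exponents divisible by \<open>u\<close>; the constant cancels because
  \<open>bcoeff\<close> is a domain.\<close>

lemma jackson_unique:
  assumes "1 - P \<noteq> 0" "sconst (1 - P) * svariable u * G = sconst (1 - P) * svariable u * H"
  shows "G = H"
proof (rule poly_mapping_eqI)
  fix \<nu>
  have "Poly_Mapping.lookup (sconst (1 - P) * (svariable u * G)) (Poly_Mapping.single u 1 + \<nu>)
      = Poly_Mapping.lookup (sconst (1 - P) * (svariable u * H)) (Poly_Mapping.single u 1 + \<nu>)"
    using assms(2) by (simp only: mult.assoc)
  then show "Poly_Mapping.lookup G \<nu> = Poly_Mapping.lookup H \<nu>"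
    using assms(1) by (simp only: lookup_sconst_mult lookup_svariable_mult_Suc mult_left_cancel[OF assms(1)])
qed

text \<open>On a monomial of degree n in \<open>u\<close> the quotient is the P-integer 1 + P + ...
  + P^(n-1) times the monomial with one power of \<open>u\<close> removed, or 0 if n = 0; both sides
  are additive in \<open>A\<close>.\<close>

lemma jackson_exists: "\<exists>G. sconst (1 - P) * svariable u * G = A - q_shift u P A"
proof (induction A rule: poly_mapping_add_induct)
  case zero
  show ?case by (rule exI[of _ 0]) (simp add: q_shift_0)
next
  case (single \<mu> c)
  show ?case
  proof (cases \<mu> u rule: exponent_cases)
    case 1
    then show ?thesis by (intro exI[of _ 0]) (simp add: q_shift_single)
  next
    case (2 \<nu>)
    define n where "n = Poly_Mapping.lookup \<mu> u"
    have "c - c * P ^ n = (1 - P) * (c * (\<Sum>k<n. P ^ k))"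
      using arg_cong[OF one_diff_power_eq[of P n], of "(*) c"]
      by (simp add: right_diff_distrib left_diff_distrib mult_ac)
    then show ?thesis
      by (intro exI[of _ "Poly_Mapping.single \<nu> (c * (\<Sum>k<n. P ^ k))"])
        (simp add: 2[symmetric] q_shift_single sconst_def svariable_def mult_single single_diff[symmetric]
          flip: n_def One_nat_def)
  qed
next
  case (add A B)
  then obtain G H where "sconst (1 - P) * svariable u * G = A - q_shift u P A"
    "sconst (1 - P) * svariable u * H = B - q_shift u P B" by blast
  then show ?case
    by (intro exI[of _ "G + H"]) (simp add: q_shift_add distrib_left)
qed

lemma jackson_eqI:
  assumes "1 - P \<noteq> 0" "sconst (1 - P) * svariable u * G = A - q_shift u P A"
  shows "jackson u P A = G"
  unfolding jackson_def
  by (rule the_equality) (use assms jackson_unique[OF assms(1)] in \<open>metis+\<close>)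

lemma jackson_eq:
  assumes "1 - P \<noteq> 0"
  shows "sconst (1 - P) * svariable u * jackson u P A = A - q_shift u P A"
  using jackson_exists jackson_eqI[OF assms] by metis

lemma jackson_add:
  assumes "1 - P \<noteq> 0"
  shows "jackson u P (A + B) = jackson u P A + jackson u P B"
  by (rule jackson_eqI[OF assms]) (simp add: distrib_left jackson_eq[OF assms] q_shift_add)

lemma jackson_sconst:
  assumes "1 - P \<noteq> 0"
  shows "jackson u P (sconst c * A) = sconst c * jackson u P A"
proof (rule jackson_eqI[OF assms])
  have "sconst (1 - P) * svariable u * (sconst c * jackson u P A)
      = sconst c * (sconst (1 - P) * svariable u * jackson u P A)" by (simp only: mult_ac)
  then show "sconst (1 - P) * svariable u * (sconst c * jackson u P A) = sconst c * A - q_shift u P (sconst c * A)"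
    by (simp add: jackson_eq[OF assms] q_shift_sconst right_diff_distrib)
qed

lemma q_B_neq: "1 - q_B \<noteq> 0" "1 - q_B ^ 2 \<noteq> 0"
proof -
  show "1 - q_B \<noteq> 0"
    by transfer (simp add: frac_q_def One_fract_def Zero_fract_def eq_fract one_pCons)
  have "1 - q_B * q_B \<noteq> 0"
    by transfer (simp add: frac_q_def One_fract_def Zero_fract_def eq_fract one_pCons)
  then show "1 - q_B ^ 2 \<noteq> 0" by (simp add: power2_eq_square)
qed

lemmas jackson_simps = jackson_add[OF q_B_neq(1)] jackson_add[OF q_B_neq(2)]
  jackson_sconst[OF q_B_neq(1)] jackson_sconst[OF q_B_neq(2)]

section \<open>Stability of the scalar algebra under the operators\<close>

lemma scalar_algebra_iff:
  "A \<in> scalar_algebra N \<longleftrightarrow> (\<forall>\<mu>. Poly_Mapping.lookup A \<mu> \<noteq> 0 \<longrightarrow> Poly_Mapping.keys \<mu> \<subseteq> svars N)"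
  by (auto simp: scalar_algebra_def in_keys_iff)

lemma keys_add_nat: "Poly_Mapping.keys (\<mu> + \<nu> :: 'a \<Rightarrow>\<^sub>0 nat) = Poly_Mapping.keys \<mu> \<union> Poly_Mapping.keys \<nu>"
  by (auto simp: in_keys_iff lookup_add)

lemma scalar_algebra_0 [simp]: "0 \<in> scalar_algebra N"
  by (simp add: scalar_algebra_def)

lemma scalar_algebra_1 [simp]: "1 \<in> scalar_algebra N"
  by (simp add: scalar_algebra_iff lookup_one when_def)

lemma scalar_algebra_add [intro]: "A \<in> scalar_algebra N \<Longrightarrow> B \<in> scalar_algebra N \<Longrightarrow> A + B \<in> scalar_algebra N"
  by (auto simp: scalar_algebra_iff lookup_add) (metis add_0 subsetD)

lemma scalar_algebra_uminus [intro]: "A \<in> scalar_algebra N \<Longrightarrow> - A \<in> scalar_algebra N"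
  by (auto simp: scalar_algebra_iff lookup_uminus)

lemma scalar_algebra_sum [intro]: "(\<And>i. i \<in> K \<Longrightarrow> f i \<in> scalar_algebra N) \<Longrightarrow> sum f K \<in> scalar_algebra N"
  by (induction K rule: infinite_finite_induct) auto

lemma scalar_algebra_minus_one_power: "A \<in> scalar_algebra N \<Longrightarrow> (- 1) ^ p * A \<in> scalar_algebra N"
  by (induction p) (auto simp: mult.assoc)

lemma scalar_algebra_sconst [intro]: "A \<in> scalar_algebra N \<Longrightarrow> sconst c * A \<in> scalar_algebra N"
  by (auto simp: scalar_algebra_iff lookup_sconst_mult)

lemma scalar_algebra_svariable [intro]:
  assumes "u \<in> svars N" "A \<in> scalar_algebra N"
  shows "svariable u * A \<in> scalar_algebra N"
  unfolding scalar_algebra_iff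
proof (intro allI impI)
  fix \<mu> assume "Poly_Mapping.lookup (svariable u * A) \<mu> \<noteq> 0"
  then show "Poly_Mapping.keys \<mu> \<subseteq> svars N"
    using assms
    by (cases \<mu> u rule: exponent_cases)
      (auto simp: lookup_svariable_mult_0 lookup_svariable_mult_Suc[simplified] keys_add_nat scalar_algebra_iff split: if_splits)
qed

lemma scalar_algebra_q_shift [intro]: "A \<in> scalar_algebra N \<Longrightarrow> q_shift u P A \<in> scalar_algebra N"
  by (auto simp: scalar_algebra_iff lookup_q_shift)

text \<open>A monomial \<nu> of the quotient forces the monomial \<open>u\<close> times \<nu> in
  \<open>A\<close>, because the shift creates no new monomials. Hence the variables of \<nu> already
  occur in \<open>A\<close>.\<close>

lemma scalar_algebra_jackson:
  assumes P: "1 - P \<noteq> 0" and A: "A \<in> scalar_algebra N"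
  shows "jackson u P A \<in> scalar_algebra N"
  unfolding scalar_algebra_iff
proof (intro allI impI)
  fix \<nu> assume \<nu>: "Poly_Mapping.lookup (jackson u P A) \<nu> \<noteq> 0"
  let ?\<mu> = "Poly_Mapping.single u 1 + \<nu>"
  have "(1 - P) * Poly_Mapping.lookup (jackson u P A) \<nu> = Poly_Mapping.lookup (A - q_shift u P A) ?\<mu>"
    by (simp only: jackson_eq[OF P, symmetric] mult.assoc lookup_sconst_mult lookup_svariable_mult_Suc)
  then have "Poly_Mapping.lookup (A - q_shift u P A) ?\<mu> \<noteq> 0"
    using P \<nu> by (metis mult_eq_0_iff)
  then have "Poly_Mapping.lookup A ?\<mu> \<noteq> 0"
    by (auto simp: lookup_minus lookup_q_shift)
  then have "Poly_Mapping.keys ?\<mu> \<subseteq> svars N"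
    by (rule A[unfolded scalar_algebra_iff, rule_format])
  then show "Poly_Mapping.keys \<nu> \<subseteq> svars N" by (simp add: keys_add_nat)
qed

lemma svars_simps: "R_var \<in> svars N" "S_var i \<in> svars N \<longleftrightarrow> 1 \<le> i \<and> i \<le> N"
  "C_var i j \<in> svars N \<longleftrightarrow> 1 \<le> i \<and> i \<le> j \<and> j \<le> N"
  by (auto simp: svars_def)

lemma E_sc_scalar_algebra: "A \<in> scalar_algebra N \<Longrightarrow> E_sc N A \<in> scalar_algebra N"
  unfolding E_sc_def mult.assoc
  by (intro scalar_algebra_add scalar_algebra_sconst scalar_algebra_svariable scalar_algebra_q_shift
      scalar_algebra_sum scalar_algebra_jackson q_B_neq) (auto simp: svars_simps)

lemma Delta_scalar_algebra: "A \<in> scalar_algebra N \<Longrightarrow> Delta N p A \<in> scalar_algebra N"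
  unfolding Delta_def
  by (intro scalar_algebra_minus_one_power scalar_algebra_add scalar_algebra_sconst E_sc_scalar_algebra)

lemma E_sc_add: "E_sc N (A + B) = E_sc N A + E_sc N B"
  by (simp add: E_sc_def jackson_simps q_shift_add distrib_left sum.distrib algebra_simps)

lemma Delta_add: "Delta N p (A + B) = Delta N p A + Delta N p B"
  by (simp add: Delta_def E_sc_add algebra_simps)

text \<open>Multiplying by one admissible variable at a time fits evaluation into the noncommutative
  algebra, where the product rule is first known only for a constant or a single variable; full
  multiplicativity then follows by this induction.\<close>

lemma scalar_algebra_induct [consumes 1, case_names const add svariable]:
  assumes A: "A \<in> scalar_algebra N"
    and const: "\<And>c. Q (sconst c)"
    and add: "\<And>A B. Q A \<Longrightarrow> Q B \<Longrightarrow> Q (A + B)"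
    and var: "\<And>u A. u \<in> svars N \<Longrightarrow> Q A \<Longrightarrow> Q (svariable u * A)"
  shows "Q A"
proof -
  have s: "Poly_Mapping.keys \<mu> \<subseteq> svars N \<Longrightarrow> Q B \<Longrightarrow> Q (Poly_Mapping.single \<mu> 1 * B)" for \<mu> B
  proof (induction \<mu> arbitrary: B rule: poly_mapping_add_induct)
    case (single u n)
    then show ?case
    proof (induction n)
      case (Suc n)
      then have u: "u \<in> svars N" by simp
      have "Poly_Mapping.single (Poly_Mapping.single u (Suc n)) 1
          = svariable u * Poly_Mapping.single (Poly_Mapping.single u n) 1"
        by (simp add: svariable_def mult_single flip: single_add)
      moreover have "Q (Poly_Mapping.single (Poly_Mapping.single u n) 1 * B)"
        using Suc u by simp
      ultimately show ?case using var[OF u] by (simp add: mult.assoc)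
    qed simp
  next
    case (add \<mu> \<nu>)
    have "Poly_Mapping.single (\<mu> + \<nu>) 1 = Poly_Mapping.single \<mu> (1::bcoeff) * Poly_Mapping.single \<nu> 1"
      by (simp add: mult_single)
    then show ?case using add by (simp add: keys_add_nat mult.assoc)
  qed simp
  have eq: "A = (\<Sum>\<mu>\<in>Poly_Mapping.keys A. Poly_Mapping.single \<mu> 1 * sconst (Poly_Mapping.lookup A \<mu>))"
    by (rule poly_mapping_eqI)
      (simp add: sconst_def mult_single lookup_sum lookup_single when_def sum.delta in_keys_iff)
  have sum: "Q (\<Sum>\<mu>\<in>K. Poly_Mapping.single \<mu> 1 * sconst (Poly_Mapping.lookup A \<mu>))"
    if "K \<subseteq> Poly_Mapping.keys A" for K
    using finite_subset[OF that finite_keys] that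
  proof (induction K rule: finite_induct)
    case empty
    then show ?case using const[of 0] by (simp add: sconst_def)
  next
    case (insert \<mu> K)
    then have "Poly_Mapping.keys \<mu> \<subseteq> svars N" using A by (auto simp: scalar_algebra_def)
    then show ?case using insert by (auto intro: add s const)
  qed
  show ?thesis by (subst eq) (rule sum[OF order_refl])
qed

section \<open>Centrality of the scalars and evaluation of polynomials\<close>

lemma central_mult:
  fixes a :: "'a::semigroup_mult"
  assumes "\<And>b. a * b = b * a" "\<And>b. c * b = b * c"
  shows "a * c * b = b * (a * c)"
proof -
  have "a * c * b = a * b * c" by (simp only: mult.assoc assms(2)[of b])
  then show ?thesis by (simp only: assms(1)[of b] mult.assoc)
qed

lemma radial_half_cancel: "a + a = b + b \<Longrightarrow> a = (b :: 'a::real_vector)"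
  by (simp flip: scaleR_2)

text \<open>The defining relations give commutation with the variables only; sums and products are
  reached by induction over the algebra.\<close>

lemma anticomm_central: "anticomm (radial_var u) (radial_var v) * a = a * anticomm (radial_var u) (radial_var v)"
  (is "?g * a = a * ?g")
proof (induction a rule: radial_induct)
  case (var w)
  then show ?case using radial_relation[of u v w] by (simp add: comm_def)
next
  case (const c)
  then show ?case by (simp add: radial_const_central)
next
  case (add a b)
  then show ?case by (simp add: distrib_left distrib_right)
next
  case (mult a b)
  have "?g * (a * b) = (?g * a) * b" by (simp only: mult.assoc)
  also have "\<dots> = a * (?g * b)" by (simp only: mult.assoc mult(1))
  finally show ?case by (simp only: mult.assoc mult(2))
qed

lemma svar_value_central: "svar_value x y u * a = a * svar_value x y u"
proof (cases u)
  case R_var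
  \<comment> \<open>The square is half an anticommutator, so its centrality follows after doubling
    and cancelling the 2.\<close>
  have "z^2 + z^2 = anticomm z z" for z :: "'a rad" by (simp add: anticomm_def power2_eq_square)
  then have "radial_var x^2 * a + radial_var x^2 * a = a * radial_var x^2 + a * radial_var x^2"
    using anticomm_central[of x x a] by (metis distrib_left distrib_right)
  from radial_half_cancel[OF this] show ?thesis by (simp add: R_var)
qed (simp_all add: anticomm_central)

lemma svar_value_power_central: "svar_value x y u ^ n * a = a * svar_value x y u ^ n"
  by (induction n arbitrary: a) (simp, simp add: central_mult[OF svar_value_central])

text \<open>The fold of \<open>monomial_value\<close> with exponents and index set decoupled: it may
  then run over any finite superset of the support, where zero exponents contribute the factor
  1.\<close>

definition monomial_fold :: "'v \<Rightarrow> (nat \<Rightarrow> 'v) \<Rightarrow> (svar \<Rightarrow> nat) \<Rightarrow> svar set \<Rightarrow> 'v rad" where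
  "monomial_fold x y n K = Finite_Set.fold (\<lambda>u z. svar_value x y u ^ n u * z) 1 K"

lemma monomial_fold_insert:
  assumes "finite K" "u \<notin> K"
  shows "monomial_fold x y n (insert u K) = svar_value x y u ^ n u * monomial_fold x y n K"
proof -
  interpret comp_fun_commute "\<lambda>u z. svar_value x y u ^ n u * z"
  proof
    fix u w
    have "svar_value x y u ^ n u * (svar_value x y w ^ n w * z)
        = svar_value x y w ^ n w * (svar_value x y u ^ n u * z)" for z
      by (simp only: mult.assoc[symmetric] svar_value_power_central[of x y u "n u" "svar_value x y w ^ n w"])
    then show "(\<lambda>z. svar_value x y u ^ n u * z) \<circ> (\<lambda>z. svar_value x y w ^ n w * z)
        = (\<lambda>z. svar_value x y w ^ n w * z) \<circ> (\<lambda>z. svar_value x y u ^ n u * z)"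
      by (simp add: fun_eq_iff)
  qed
  show ?thesis using assms by (simp add: monomial_fold_def)
qed

lemma monomial_fold_empty: "monomial_fold x y n {} = 1"
  by (simp add: monomial_fold_def)

lemma monomial_fold_cong:
  assumes "finite K" "\<And>u. u \<in> K \<Longrightarrow> n u = n' u"
  shows "monomial_fold x y n K = monomial_fold x y n' K"
  using assms by (induction K rule: finite_induct) (simp_all add: monomial_fold_empty monomial_fold_insert)

lemma monomial_value_superset:
  assumes "finite K" "Poly_Mapping.keys \<mu> \<subseteq> K"
  shows "monomial_value x y \<mu> = monomial_fold x y (Poly_Mapping.lookup \<mu>) K"
proof -
  have "finite D \<Longrightarrow> D \<inter> Poly_Mapping.keys \<mu> = {} \<Longrightarrow>
      monomial_fold x y (Poly_Mapping.lookup \<mu>) (D \<union> Poly_Mapping.keys \<mu>) = monomial_value x y \<mu>" for D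
  proof (induction D rule: finite_induct)
    case (insert u D)
    then have "Poly_Mapping.lookup \<mu> u = 0" by (auto simp: in_keys_iff)
    then show ?case using insert by (simp add: monomial_fold_insert)
  qed (simp add: monomial_value_def monomial_fold_def)
  from this[of "K - Poly_Mapping.keys \<mu>"] show ?thesis
    using assms by (simp add: Un_absorb2 Int_commute)
qed

lemma monomial_value_Suc:
  "monomial_value x y (Poly_Mapping.single u 1 + \<nu>) = svar_value x y u * monomial_value x y \<nu>"
proof -
  \<comment> \<open>Both monomials are folded over \<open>insert u K\<close>, so that they differ in
    the factor of \<open>u\<close> alone, whether or not \<open>u\<close> occurs in \<nu>.\<close>
  define K where "K = Poly_Mapping.keys \<nu> - {u}"
  have K: "finite K" "u \<notin> K" by (simp_all add: K_def)
  have "Poly_Mapping.keys (Poly_Mapping.single u 1 + \<nu>) \<subseteq> insert u K" "Poly_Mapping.keys \<nu> \<subseteq> insert u K"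
    by (auto simp: K_def keys_add_nat)
  moreover have "monomial_fold x y (Poly_Mapping.lookup (Poly_Mapping.single u 1 + \<nu>)) K
      = monomial_fold x y (Poly_Mapping.lookup \<nu>) K"
    using K by (intro monomial_fold_cong) (auto simp: lookup_add lookup_single when_def)
  ultimately show ?thesis
    using K by (simp add: monomial_value_superset[of "insert u K"] monomial_fold_insert lookup_add mult.assoc)
qed

lemma radial_const_simps:
  fixes c d :: "'k::comm_ring_1"
  shows "radial_const (0::'k) = (0 :: ('v, 'k) radial)" "radial_const (1::'k) = (1 :: ('v, 'k) radial)"
    "radial_const (c + d) = (radial_const c + radial_const d :: ('v, 'k) radial)"
    "radial_const (c * d) = (radial_const c * radial_const d :: ('v, 'k) radial)"
  using radial_const_hom[where 'v = 'v and 'k = 'k] is_ring_hom_0[OF radial_const_hom[where 'v = 'v and 'k = 'k]]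
  by (simp_all add: is_ring_hom_def)

lemma scalar_eval_superset:
  assumes "finite K" "Poly_Mapping.keys A \<subseteq> K"
  shows "scalar_eval x y A = (\<Sum>\<mu>\<in>K. radial_const (Poly_Mapping.lookup A \<mu>) * monomial_value x y \<mu>)"
  unfolding scalar_eval_def
  by (rule sum.mono_neutral_left) (use assms in \<open>auto simp: in_keys_iff radial_const_simps\<close>)

lemma scalar_eval_add: "scalar_eval x y (A + B) = scalar_eval x y A + scalar_eval x y B"
proof -
  let ?K = "Poly_Mapping.keys A \<union> Poly_Mapping.keys B"
  have "Poly_Mapping.keys (A + B) \<subseteq> ?K" by (rule Poly_Mapping.keys_add)
  then show ?thesis
    by (simp add: scalar_eval_superset[of ?K] lookup_add radial_const_simps distrib_right sum.distrib)
qed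

lemma scalar_eval_0: "scalar_eval x y 0 = 0"
  by (simp add: scalar_eval_def)

lemma scalar_eval_uminus: "scalar_eval x y (- A) = - scalar_eval x y A"
  using scalar_eval_add[of x y A "- A"] by (simp add: scalar_eval_0 eq_neg_iff_add_eq_0 add.commute)

lemma scalar_eval_sum: "scalar_eval x y (sum f K) = (\<Sum>i\<in>K. scalar_eval x y (f i))"
  by (induction K rule: infinite_finite_induct) (simp_all add: scalar_eval_0 scalar_eval_add)

lemma scalar_eval_single: "scalar_eval x y (Poly_Mapping.single \<mu> c) = radial_const c * monomial_value x y \<mu>"
  by (simp add: scalar_eval_superset[of "{\<mu>}"])

lemma scalar_eval_sconst_mult: "scalar_eval x y (sconst c * A) = radial_const c * scalar_eval x y A"
  by (induction A rule: poly_mapping_add_induct)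
    (simp_all add: scalar_eval_0 scalar_eval_add distrib_left sconst_def mult_single scalar_eval_single
      radial_const_simps mult.assoc)

lemma scalar_eval_svariable_mult: "scalar_eval x y (svariable u * A) = svar_value x y u * scalar_eval x y A"
proof (induction A rule: poly_mapping_add_induct)
  case (single \<mu> c)
  have "radial_const c * (svar_value x y u * a) = svar_value x y u * (radial_const c * a)" for a
    by (simp only: mult.assoc[symmetric] radial_const_central[of c "svar_value x y u"])
  then show ?case
    by (simp add: svariable_def mult_single scalar_eval_single monomial_value_Suc[simplified])
qed (simp_all add: scalar_eval_0 scalar_eval_add distrib_left)

lemma scalar_eval_1: "scalar_eval x y 1 = 1"
  using scalar_eval_single[of x y 0 1]
  by (simp add: radial_const_simps monomial_value_superset[of "{}"] monomial_fold_empty)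

lemma scalar_eval_sconst: "scalar_eval x y (sconst c) = radial_const c"
  using scalar_eval_sconst_mult[of x y c 1] by (simp add: scalar_eval_1)

lemma scalar_eval_central:
  "scalar_eval x y A * a = a * scalar_eval x y A"
proof -
  have "finite K \<Longrightarrow> monomial_fold x y n K * a = a * monomial_fold x y n K" for n K a
    by (induction K arbitrary: a rule: finite_induct)
      (simp_all add: monomial_fold_empty monomial_fold_insert central_mult[OF svar_value_power_central])
  then have "monomial_value x y \<mu> * a = a * monomial_value x y \<mu>" for \<mu> a
    by (simp add: monomial_value_superset[of "Poly_Mapping.keys \<mu>"])
  then have "radial_const c * monomial_value x y \<mu> * a = a * (radial_const c * monomial_value x y \<mu>)" for c \<mu>
    by (intro central_mult radial_const_central)
  then show ?thesis
    by (simp add: scalar_eval_def sum_distrib_left sum_distrib_right)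
qed

section \<open>The action on the exterior module\<close>

text \<open>The universal property in terms of the images of the variables. It is what lets the
  exterior module become a representation once the Clifford relations are checked there.\<close>

lemma radial_hom_exists:
  fixes \<phi> :: "'k::comm_ring_1 \<Rightarrow> 'c::ring_1" and g :: "'v \<Rightarrow> 'c"
  assumes \<phi>: "is_ring_hom \<phi>" and commute: "\<And>c v. \<phi> c * g v = g v * \<phi> c"
    and rel: "\<And>u v w. comm (anticomm (g u) (g v)) (g w) = 0"
  obtains F :: "('v, 'k) radial \<Rightarrow> 'c"
  where "is_ring_hom F" "\<And>c. F (radial_const c) = \<phi> c" "\<And>v. F (radial_var v) = g v"
proof
  let ?E = "free_eval \<phi> g"
  let ?F = "\<lambda>z. ?E (rep_radial z)"
  have E: "is_ring_hom ?E" by (rule free_eval_hom[OF \<phi> commute])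
  have cong: "?E a = ?E b" if "radial_eq a b" for a b
  proof -
    have "?E (a - b) = 0"
      by (rule hom_radial_ideal[OF E]) (use that rel in \<open>simp_all add: radial_eq_def free_eval_var[OF \<phi>]\<close>)
    then show ?thesis by (simp add: is_ring_hom_diff[OF E])
  qed
  have abs: "?F (abs_radial a) = ?E a" for a
    by (rule cong) (simp add: Quotient3_radial rep_abs_rsp_left radial_eqI)
  show "?F (radial_const c) = \<phi> c" for c
    by (simp add: radial_const.abs_eq abs free_eval_const[OF \<phi>])
  show "?F (radial_var v) = g v" for v
    by (simp add: radial_var.abs_eq abs free_eval_var[OF \<phi>])
  show "is_ring_hom ?F"
    unfolding is_ring_hom_def
  proof (intro conjI allI)
    show "?F 1 = 1" using E by (simp add: one_radial.abs_eq abs is_ring_hom_def)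
    fix a b
    show "?F (a + b) = ?F a + ?F b"
      by (induction a rule: radial.abs_induct, induction b rule: radial.abs_induct)
        (use E in \<open>simp add: plus_radial.abs_eq abs is_ring_hom_def\<close>)
    show "?F (a * b) = ?F a * ?F b"
      by (induction a rule: radial.abs_induct, induction b rule: radial.abs_induct)
        (use E in \<open>simp add: times_radial.abs_eq abs is_ring_hom_def\<close>)
  qed
qed

text \<open>The product below is composition in reverse order, since the radial algebra acts from the right.\<close>

typedef exterior_op = "{f :: (nat set \<Rightarrow> spoly) \<Rightarrow> (nat set \<Rightarrow> spoly). additive f}"
  by (rule exI[of _ "\<lambda>f. f"]) (simp add: additive_def)

setup_lifting type_definition_exterior_op

instantiation exterior_op :: ring_1
begin

lift_definition zero_exterior_op :: exterior_op is "\<lambda>f. 0" by (simp add: additive_def)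
lift_definition one_exterior_op :: exterior_op is "\<lambda>f. f" by (simp add: additive_def)
lift_definition plus_exterior_op :: "exterior_op \<Rightarrow> exterior_op \<Rightarrow> exterior_op" is "\<lambda>F G f. F f + G f"
  by (simp add: additive_def)
lift_definition uminus_exterior_op :: "exterior_op \<Rightarrow> exterior_op" is "\<lambda>F f. - F f"
  by (simp add: additive_def)
lift_definition minus_exterior_op :: "exterior_op \<Rightarrow> exterior_op \<Rightarrow> exterior_op" is "\<lambda>F G f. F f - G f"
  by (simp add: additive_def)
lift_definition times_exterior_op :: "exterior_op \<Rightarrow> exterior_op \<Rightarrow> exterior_op" is "\<lambda>F G f. G (F f)"
  by (simp add: additive_def)

instance
proof
  show "(0 :: exterior_op) \<noteq> 1"
  proof (transfer, rule notI)
    assume "(\<lambda>f::nat set \<Rightarrow> spoly. 0) = (\<lambda>f. f)"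
    then have "(\<lambda>J. 0) = ((\<lambda>J. 1) :: nat set \<Rightarrow> spoly)" unfolding zero_fun_def by meson
    then show False by (meson zero_neq_one)
  qed
qed (transfer, simp add: additive_def fun_eq_iff algebra_simps)+

end

text \<open>Module elements are arbitrary functions of the index set \<open>K\<close>; the bound \<open>k \<le> N\<close> keeps the sign
  rules, and with them the Clifford relations, valid for infinite \<open>K\<close> as well.\<close>

definition wsign :: "nat \<Rightarrow> nat \<Rightarrow> nat set \<Rightarrow> spoly" where
  "wsign N i K = (- 1) ^ card {k \<in> K. i < k \<and> k \<le> N}"

lemma wsign_sq: "wsign N i K * wsign N i K = 1" "wsign N i K * (wsign N i K * A) = A"
  by (simp_all add: wsign_def flip: power_add mult.assoc)

lemma wsign_insert:
  assumes "j \<notin> K" "j \<le> N"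
  shows "wsign N i (insert j K) = (if i < j then - wsign N i K else wsign N i K)"
proof -
  have "{k \<in> insert j K. i < k \<and> k \<le> N} = (if i < j then insert j else id) {k \<in> K. i < k \<and> k \<le> N}"
    using assms by auto
  then show ?thesis using assms by (simp add: wsign_def)
qed

lemma wsign_remove:
  assumes "j \<in> K" "j \<le> N"
  shows "wsign N i (K - {j}) = (if i < j then - wsign N i K else wsign N i K)"
  using wsign_insert[of j "K - {j}" N i] assms by (simp add: insert_absorb split: if_splits)

text \<open>Right exterior multiplication by the \<open>i\<close>-th basis vector, written on
  coefficient functions. The sign carries the new factor from the last place to its sorted place,
  past all larger indices.\<close>

definition create :: "nat \<Rightarrow> nat \<Rightarrow> (nat set \<Rightarrow> spoly) \<Rightarrow> nat set \<Rightarrow> spoly" where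
  "create N i f K = (if i \<in> K then wsign N i K * f (K - {i}) else 0)"

text \<open>Contraction from the right with the \<open>i\<close>-th dual basis vector, again on
  coefficient functions; the sign brings the factor \<open>i\<close> to the last place before it is
  removed.\<close>

definition annihilate :: "nat \<Rightarrow> nat \<Rightarrow> (nat set \<Rightarrow> spoly) \<Rightarrow> nat set \<Rightarrow> spoly" where
  "annihilate N i f K = (if i \<in> K then 0 else wsign N i K * f (insert i K))"

text \<open>With the next two lemmas these are the canonical anticommutation relations. For i < j
  the presence of j flips the sign attached to i but not conversely, so the two orders differ by
  exactly one sign.\<close>

lemma create_create:
  assumes "i \<le> N" "j \<le> N"
  shows "create N i (create N j f) K + create N j (create N i f) K = 0"
proof (cases "i \<in> K \<and> j \<in> K \<and> i \<noteq> j")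
  case True
  have "K - {j} - {i} = K - {i} - {j}" by auto
  then show ?thesis using True assms
    by (cases "i < j") (simp_all add: create_def wsign_remove mult_ac)
qed (auto simp: create_def)

lemma annihilate_annihilate:
  assumes "i \<le> N" "j \<le> N"
  shows "annihilate N i (annihilate N j f) K + annihilate N j (annihilate N i f) K = 0"
proof (cases "i \<notin> K \<and> j \<notin> K \<and> i \<noteq> j")
  case True
  then show ?thesis using assms
    by (cases "i < j") (simp_all add: annihilate_def wsign_insert insert_commute mult_ac)
qed (auto simp: annihilate_def)

lemma create_annihilate:
  assumes "i \<le> N" "j \<le> N"
  shows "create N i (annihilate N j f) K + annihilate N j (create N i f) K = (if i = j then f K else 0)"
proof (cases "i = j")
  case True
  then show ?thesis using assms
    by (auto simp: create_def annihilate_def wsign_insert wsign_remove wsign_sq insert_absorb)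
next
  case False
  then have "insert j (K - {i}) = insert j K - {i}" by auto
  then show ?thesis using assms False
    by (cases "i < j") (simp_all add: create_def annihilate_def wsign_insert wsign_remove mult_ac)
qed

text \<open>The Gram entry {v_i, v_j}/2 as a polynomial, where v_0 = x; at (0,0) this is x^2 = r.
  \<open>min\<close> and \<open>max\<close> select the variable c_ij with i \<le> j, the only form
  that occurs in \<open>svars\<close>.\<close>

definition half_gram :: "nat \<Rightarrow> nat \<Rightarrow> spoly" where
  "half_gram i j =
    (if i = 0 \<and> j = 0 then svariable R_var
     else sconst (of_real (1 / 2)) * svariable
       (if i = 0 then S_var j else if j = 0 then S_var i else C_var (min i j) (max i j)))"

lemma half_gram_sym: "half_gram i j = half_gram j i"
  by (simp add: half_gram_def min.commute max.commute)

text \<open>Right multiplication by the \<open>i\<close>-th vector variable, where index \<open>0\<close> stands for \<open>x\<close>.\<close>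

definition vmult :: "nat \<Rightarrow> nat \<Rightarrow> (nat set \<Rightarrow> spoly) \<Rightarrow> nat set \<Rightarrow> spoly" where
  "vmult N i f K = create N i f K + (\<Sum>k\<le>N. half_gram i k * annihilate N k f K)"

text \<open>The Clifford relation for creation plus a Gram combination of annihilations: the pure
  creation and pure annihilation terms cancel, and the two mixed groups each contribute one Gram
  entry.\<close>

lemma vmult_anticomm:
  assumes i: "i \<le> N" and j: "j \<le> N"
  shows "vmult N i (vmult N j f) K + vmult N j (vmult N i f) K = (half_gram i j + half_gram i j) * f K"
proof -
  have c: "create N i (vmult N j f) K = create N i (create N j f) K
      + (\<Sum>k\<le>N. half_gram j k * create N i (annihilate N k f) K)" for i j
    by (simp add: create_def[of _ i] vmult_def distrib_left sum_distrib_left mult_ac)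
  have a: "annihilate N l (vmult N j f) K = annihilate N l (create N j f) K
      + (\<Sum>k\<le>N. half_gram j k * annihilate N l (annihilate N k f) K)" for l j
    by (simp add: annihilate_def[of _ l] vmult_def distrib_left sum_distrib_left mult_ac)
  have e: "vmult N i (vmult N j f) K = create N i (create N j f) K
      + (\<Sum>k\<le>N. half_gram j k * create N i (annihilate N k f) K)
      + (\<Sum>k\<le>N. half_gram i k * annihilate N k (create N j f) K)
      + (\<Sum>l\<le>N. \<Sum>k\<le>N. half_gram i l * half_gram j k * annihilate N l (annihilate N k f) K)" for i j
    by (simp add: vmult_def[of N i] c a distrib_left sum.distrib sum_distrib_left mult.assoc)
  have s: "(\<Sum>l\<le>N. \<Sum>k\<le>N. half_gram j l * half_gram i k * annihilate N l (annihilate N k f) K)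
      = (\<Sum>l\<le>N. \<Sum>k\<le>N. half_gram i l * half_gram j k * annihilate N k (annihilate N l f) K)"
    by (subst sum.swap) (simp add: mult_ac)
  have d: "(\<Sum>k\<le>N. half_gram j k * create N i (annihilate N k f) K)
      + (\<Sum>k\<le>N. half_gram j k * annihilate N k (create N i f) K) = half_gram j i * f K" if "i \<le> N" for i j
  proof -
    have "(\<Sum>k\<le>N. half_gram j k * create N i (annihilate N k f) K)
        + (\<Sum>k\<le>N. half_gram j k * annihilate N k (create N i f) K)
        = (\<Sum>k\<le>N. half_gram j k * (if i = k then f K else 0))"
      unfolding sum.distrib[symmetric] distrib_left[symmetric]
      by (intro sum.cong refl) (simp add: create_annihilate[OF that])
    also have "\<dots> = (\<Sum>k\<le>N. if i = k then half_gram j k * f K else 0)"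
      by (intro sum.cong) auto
    finally show ?thesis using that by simp
  qed
  have "(\<Sum>l\<le>N. \<Sum>k\<le>N. half_gram i l * half_gram j k * annihilate N l (annihilate N k f) K)
      + (\<Sum>l\<le>N. \<Sum>k\<le>N. half_gram i l * half_gram j k * annihilate N k (annihilate N l f) K) = 0"
    unfolding sum.distrib[symmetric] distrib_left[symmetric]
    by (intro sum.neutral ballI) (simp add: annihilate_annihilate)
  moreover have "vmult N i (vmult N j f) K + vmult N j (vmult N i f) K
      = (create N i (create N j f) K + create N j (create N i f) K)
      + ((\<Sum>k\<le>N. half_gram j k * create N i (annihilate N k f) K)
        + (\<Sum>k\<le>N. half_gram j k * annihilate N k (create N i f) K))
      + ((\<Sum>k\<le>N. half_gram i k * create N j (annihilate N k f) K)
        + (\<Sum>k\<le>N. half_gram i k * annihilate N k (create N j f) K))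
      + ((\<Sum>l\<le>N. \<Sum>k\<le>N. half_gram i l * half_gram j k * annihilate N l (annihilate N k f) K)
        + (\<Sum>l\<le>N. \<Sum>k\<le>N. half_gram i l * half_gram j k * annihilate N k (annihilate N l f) K))"
    unfolding e s by (simp only: add_ac)
  ultimately show ?thesis
    unfolding create_create[OF i j] d[OF i] d[OF j] half_gram_sym[of j i]
    by (simp add: distrib_right)
qed

lemma additive_vmult: "additive (vmult N i)"
proof -
  have "create N i (f + g) K = create N i f K + create N i g K"
    "annihilate N k (f + g) K = annihilate N k f K + annihilate N k g K" for k f g K
    by (simp_all add: create_def annihilate_def distrib_left)
  then show ?thesis
    by (simp add: additive_def fun_eq_iff vmult_def distrib_left sum.distrib)
qed

lemma vmult_scale: "vmult N i (\<lambda>K. A * f K) = (\<lambda>K. A * vmult N i f K)"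
proof -
  have "create N i (\<lambda>K. A * f K) K = A * create N i f K"
    "annihilate N k (\<lambda>K. A * f K) K = A * annihilate N k f K" for k K
    by (simp_all add: create_def annihilate_def mult_ac)
  then show ?thesis
    by (simp add: fun_eq_iff vmult_def distrib_left sum_distrib_left mult.left_commute)
qed

section \<open>Scalars and vectors as elements of the operator ring\<close>

definition scale_op :: "spoly \<Rightarrow> exterior_op" where
  "scale_op A = Abs_exterior_op (\<lambda>f K. A * f K)"

lemma Rep_scale_op: "Rep_exterior_op (scale_op A) = (\<lambda>f K. A * f K)"
  unfolding scale_op_def
  by (rule Abs_exterior_op_inverse) (simp add: additive_def fun_eq_iff distrib_left)

lift_definition vmult_op :: "nat \<Rightarrow> nat \<Rightarrow> exterior_op" is vmult
  by (rule additive_vmult)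

lemmas Rep_exterior_op_simps = Rep_scale_op vmult_op.rep_eq one_exterior_op.rep_eq
  plus_exterior_op.rep_eq minus_exterior_op.rep_eq times_exterior_op.rep_eq zero_exterior_op.rep_eq

lemma scale_op_hom: "is_ring_hom scale_op"
  unfolding is_ring_hom_def Rep_exterior_op_inject[symmetric]
  by (simp add: Rep_exterior_op_simps fun_eq_iff algebra_simps)

lemma scale_vmult_op: "scale_op A * vmult_op N i = vmult_op N i * scale_op A"
  unfolding Rep_exterior_op_inject[symmetric]
  by (simp add: Rep_exterior_op_simps fun_eq_iff vmult_scale)

lemma anticomm_vmult_op:
  assumes "i \<le> N" "j \<le> N"
  shows "anticomm (vmult_op N i) (vmult_op N j) = scale_op (half_gram i j + half_gram i j)"
  unfolding anticomm_def Rep_exterior_op_inject[symmetric] using assms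
  by (simp add: Rep_exterior_op_simps fun_eq_iff vmult_anticomm half_gram_sym[of j i])

lemma sconst_hom: "is_ring_hom sconst"
  unfolding is_ring_hom_def by (simp add: sconst_def single_add mult_single)

section \<open>Signs by position and signs by index\<close>

lemma delete_at_map: "delete_at n (map f js) = map f (delete_at n js)"
  by (simp add: delete_at_def take_map drop_map)

lemma delete_at_sorted:
  assumes "finite J" "n < card J"
  shows "delete_at n (sorted_list_of_set J) = sorted_list_of_set (J - {sorted_list_of_set J ! n})"
proof -
  let ?l = "sorted_list_of_set J"
  have l: "?l = take n ?l @ ?l ! n # drop (Suc n) ?l"
    using assms by (simp add: id_take_nth_drop)
  have d: "distinct (take n ?l @ ?l ! n # drop (Suc n) ?l)"
    by (subst l[symmetric]) simp
  have s: "sorted (take n ?l @ ?l ! n # drop (Suc n) ?l)"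
    by (subst l[symmetric]) simp
  have "set (take n ?l @ ?l ! n # drop (Suc n) ?l) = J"
    by (subst l[symmetric]) (simp add: assms)
  then have "set (delete_at n ?l) = J - {?l ! n}"
    using d by (auto simp: delete_at_def)
  moreover have "sorted (delete_at n ?l)" "distinct (delete_at n ?l)"
    using s d by (auto simp: delete_at_def sorted_append)
  ultimately show ?thesis
    by (metis sorted_list_of_set.idem_if_sorted_distinct)
qed

text \<open>Converts the positional sign of \<open>wedge_mult_vector\<close> into the index-based
  sign \<open>wsign\<close> of the exterior module, so that the contractions on both sides can be
  matched.\<close>

lemma card_above_nth:
  assumes "finite J" "n < card J"
  shows "card {k \<in> J. sorted_list_of_set J ! n < k} = card J - Suc n"
proof -
  let ?l = "sorted_list_of_set J"
  have "{k \<in> J. ?l ! n < k} = set (drop (Suc n) ?l)"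
  proof (intro equalityI subsetI)
    fix k assume "k \<in> {k \<in> J. ?l ! n < k}"
    then obtain m where m: "m < length ?l" "k = ?l ! m" "?l ! n < ?l ! m"
      using assms by (metis (mono_tags, lifting) in_set_conv_nth mem_Collect_eq sorted_list_of_set.set_sorted_key_list_of_set)
    then have "n < m" using sorted_nth_mono[of ?l m n] assms by (force simp: not_le[symmetric])
    then show "k \<in> set (drop (Suc n) ?l)"
      using m by (auto simp: in_set_conv_nth intro!: exI[of _ "m - Suc n"])
  next
    fix k assume "k \<in> set (drop (Suc n) ?l)"
    then obtain m where m: "m < length ?l - Suc n" "k = ?l ! (Suc n + m)"
      by (auto simp: in_set_conv_nth)
    have "sorted_wrt (<) ?l" by simp
    then have "?l ! n < ?l ! (Suc n + m)"
      by (rule sorted_wrt_nth_less) (use m in simp_all)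
    moreover have "k \<in> J" using m assms nth_mem[of "Suc n + m" ?l] by simp
    ultimately show "k \<in> {k \<in> J. ?l ! n < k}" using m by simp
  qed
  then show ?thesis by (simp add: distinct_card)
qed

lemma scalar_eval_minus_one_power: "scalar_eval x y ((- 1) ^ p * A) = (- 1) ^ p * scalar_eval x y A"
  by (induction p) (simp_all add: scalar_eval_uminus)

section \<open>The basis of the radial algebra\<close>

lemma scalar_algebra_mult [intro]:
  assumes "A \<in> scalar_algebra N" "B \<in> scalar_algebra N"
  shows "A * B \<in> scalar_algebra N"
  using assms(1) by (induction rule: scalar_algebra_induct)
    (use assms(2) in \<open>auto simp: distrib_right mult.assoc\<close>)

lemma scalar_eval_mult:
  assumes "A \<in> scalar_algebra N"
  shows "scalar_eval x y (A * B) = scalar_eval x y A * scalar_eval x y B"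
  using assms by (induction rule: scalar_algebra_induct)
    (simp_all add: scalar_eval_add distrib_right mult.assoc scalar_eval_sconst_mult scalar_eval_sconst
      scalar_eval_svariable_mult)

lemma scalar_eval_svariable: "scalar_eval x y (svariable u) = svar_value x y u"
  using scalar_eval_svariable_mult[of x y u 1] by (simp add: scalar_eval_1)

lemma sconst_half_double: "sconst (of_real (1 / 2)) * A + sconst (of_real (1 / 2)) * A = A"
proof -
  have "sconst (of_real (1 / 2)) + sconst (of_real (1 / 2)) = (1 :: spoly)"
    by (simp add: sconst_def flip: single_add of_real_add)
  then show ?thesis by (simp flip: distrib_right)
qed

lemma anticomm_commute: "anticomm a b = anticomm b a"
  by (simp add: anticomm_def add.commute)

text \<open>Surjectivity of the bijection makes the wedges span the whole type; injectivity lets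
  each variable be assigned its index when the representation is defined.\<close>

locale radial_vars =
  fixes x :: 'v and y :: "nat \<Rightarrow> 'v" and N :: nat
  assumes bij: "bij_betw y {1..N} (UNIV - {x})"
begin

abbreviation ev :: "spoly \<Rightarrow> 'v rad" where
  "ev \<equiv> scalar_eval x y"

abbreviation SA :: "spoly set" where
  "SA \<equiv> scalar_algebra N"

text \<open>Giving x the index 0, below all others, merges the two basis families: y_I and x \<and>
  y_I become sorted wedges over \<open>I\<close> and \<open>insert 0 I\<close>.\<close>

definition vec :: "nat \<Rightarrow> 'v rad" where
  "vec i = radial_var (if i = 0 then x else y i)"

definition wedge_of :: "nat set \<Rightarrow> 'v rad" where
  "wedge_of J = wedge (map vec (sorted_list_of_set J))"

lemma y_wedge_eq:
  assumes "I \<subseteq> {1..N}"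
  shows "y_wedge y I = wedge_of I"
proof -
  have "finite I" using assms finite_subset by blast
  then show ?thesis
    unfolding y_wedge_def wedge_of_def
    by (intro arg_cong[of _ _ wedge] map_cong refl) (use assms in \<open>auto simp: vec_def\<close>)
qed

lemma xy_wedge_eq:
  assumes I: "I \<subseteq> {1..N}"
  shows "xy_wedge x y I = wedge_of (insert 0 I)"
proof -
  have fin: "finite I" using I finite_subset by blast
  have "sorted_list_of_set (set (0 # sorted_list_of_set I)) = 0 # sorted_list_of_set I"
    by (rule sorted_list_of_set.idem_if_sorted_distinct) (use fin I in auto)
  then have "sorted_list_of_set (insert 0 I) = 0 # sorted_list_of_set I" using fin by simp
  moreover have "map (\<lambda>i. radial_var (y i)) (sorted_list_of_set I) = map vec (sorted_list_of_set I)"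
    by (rule map_cong) (use I fin in \<open>auto simp: vec_def\<close>)
  moreover have "vec 0 = radial_var x" by (simp add: vec_def)
  ultimately show ?thesis by (simp only: xy_wedge_def wedge_of_def list.map)
qed

lemma vec_surj: obtains i where "i \<le> N" "radial_var v = vec i"
proof (cases "v = x")
  case True
  then show thesis by (intro that[of 0]) (simp_all add: vec_def)
next
  case False
  then have "v \<in> y ` {1..N}" using bij by (simp add: bij_betw_def)
  then obtain i where "i \<in> {1..N}" "v = y i" by blast
  then show thesis by (intro that[of i]) (auto simp: vec_def)
qed

lemma ev_half_gram:
  assumes "i \<le> N" "j \<le> N"
  shows "ev (half_gram i j) = (1 / 2) *\<^sub>R anticomm (vec i) (vec j)"
proof -
  have "(1 / 2) *\<^sub>R anticomm (radial_var x) (radial_var x) = (radial_var x ^ 2 :: 'v rad)"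
    by (simp add: anticomm_def power2_eq_square flip: scaleR_2)
  moreover have "ev (sconst (of_real (1 / 2)) * svariable u) = (1 / 2) *\<^sub>R svar_value x y u" for u
    by (simp only: scalar_eval_sconst_mult scalar_eval_svariable scaleR_radial_def)
  ultimately show ?thesis
    by (auto simp: half_gram_def scalar_eval_svariable vec_def anticomm_commute min_def max_def simp del: of_real_divide)
qed

lemma half_gram_SA: "i \<le> N \<Longrightarrow> j \<le> N \<Longrightarrow> half_gram i j \<in> SA"
  using scalar_algebra_svariable[OF _ scalar_algebra_1, of _ N]
  by (auto simp: half_gram_def svars_simps intro!: scalar_algebra_sconst)

lemma wsign_SA: "wsign N i J \<in> SA"
  using scalar_algebra_minus_one_power[OF scalar_algebra_1] by (simp add: wsign_def)

text \<open>The wedge with \<open>i\<close> appended stays unsorted here. For spanning it is a basis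
  element up to sign, or zero; for independence \<open>i\<close> is chosen largest, so the list is
  sorted anyway.\<close>

lemma wedge_of_mult:
  assumes J: "J \<subseteq> {0..N}" and i: "i \<le> N"
  shows "wedge_of J * vec i = wedge (map vec (sorted_list_of_set J @ [i])) +
    (\<Sum>j\<in>J. wedge_of (J - {j}) * ev (wsign N j J * half_gram i j))"
proof -
  let ?l = "sorted_list_of_set J"
  have fin: "finite J" using J finite_subset by blast
  have central: "anticomm (vec i) u * a = a * anticomm (vec i) u" if "u \<in> set (map vec ?l)" for u a
    using that by (auto simp: vec_def anticomm_central)
  have "wedge_of J * vec i = wedge (map vec ?l @ [vec i]) + (\<Sum>n<card J. (- 1) ^ (card J + Suc n) *
      ((1 / 2) *\<^sub>R anticomm (vec i) (map vec ?l ! n)) * wedge (delete_at n (map vec ?l)))"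
    using wedge_mult_vector[of "map vec ?l" "vec i", OF central] by (simp add: wedge_of_def)
  also have "(\<Sum>n<card J. (- 1) ^ (card J + Suc n) *
      ((1 / 2) *\<^sub>R anticomm (vec i) (map vec ?l ! n)) * wedge (delete_at n (map vec ?l)))
      = (\<Sum>n<card J. wedge_of (J - {?l ! n}) * ev (wsign N (?l ! n) J * half_gram i (?l ! n)))"
  proof (rule sum.cong[OF refl])
    fix n assume "n \<in> {..<card J}"
    then have n: "n < card J" by simp
    then have "?l ! n \<in> J" using fin nth_mem[of n ?l] by simp
    then have jN: "?l ! n \<le> N" using J by auto
    have "{k \<in> J. ?l ! n < k \<and> k \<le> N} = {k \<in> J. ?l ! n < k}" using J by auto
    then have "wsign N (?l ! n) J = (- 1) ^ (card J - Suc n)"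
      by (simp add: wsign_def card_above_nth[OF fin n])
    \<comment> \<open>The two exponents differ by an even number, which reconciles the positional
      sign with the count of larger indices.\<close>
    moreover have "card J + Suc n = (card J - Suc n) + 2 * Suc n" using n by simp
    then have "(- 1) ^ (card J + Suc n) = (- 1 :: 'v rad) ^ (card J - Suc n)"
      by (simp only: power_add power_mult) simp
    ultimately have "(- 1) ^ (card J + Suc n) * ((1 / 2) *\<^sub>R anticomm (vec i) (map vec ?l ! n))
        = ev (wsign N (?l ! n) J * half_gram i (?l ! n))"
      using n by (simp add: scalar_eval_minus_one_power ev_half_gram[OF i jN])
    then show "(- 1) ^ (card J + Suc n) * ((1 / 2) *\<^sub>R anticomm (vec i) (map vec ?l ! n))
        * wedge (delete_at n (map vec ?l))
        = wedge_of (J - {?l ! n}) * ev (wsign N (?l ! n) J * half_gram i (?l ! n))"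
      using n fin by (simp add: delete_at_map delete_at_sorted scalar_eval_central flip: wedge_of_def)
  qed
  also have "\<dots> = (\<Sum>j\<in>J. wedge_of (J - {j}) * ev (wsign N j J * half_gram i j))"
    by (rule sum.reindex_bij_betw[of "\<lambda>n. ?l ! n" "{..<card J}" J "\<lambda>j. wedge_of (J - {j}) * ev (wsign N j J * half_gram i j)"],
        rule bij_betw_nth) (simp_all add: fin)
  finally show ?thesis by simp
qed

lemma wedge_of_snoc:
  assumes "finite J"
  shows "wedge (map vec (sorted_list_of_set J @ [i])) = 0 \<and> i \<in> J \<or> i \<notin> J \<and>
    (wedge (map vec (sorted_list_of_set J @ [i])) = wedge_of (insert i J) \<or>
     wedge (map vec (sorted_list_of_set J @ [i])) = - wedge_of (insert i J))"
proof (cases "i \<in> J")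
  case True
  then show ?thesis using assms by (intro disjI1 conjI wedge_not_distinct) (auto simp: distinct_map)
next
  case False
  have "mset (sorted_list_of_set J @ [i]) = mset (sorted_list_of_set (insert i J))"
    using assms False by simp
  then have "mset (map vec (sorted_list_of_set J @ [i])) = mset (map vec (sorted_list_of_set (insert i J)))"
    by (simp only: mset_map)
  then show ?thesis using wedge_mset_eq False unfolding wedge_of_def by blast
qed

text \<open>The radial relations hold because anticommutators of vector operators are
  multiplications by polynomials, which commute with every vector operator. The last clause is
  confined to \<open>SA\<close>: a polynomial mentioning an index above \<open>N\<close> is
  evaluated at an arbitrary value of \<open>y\<close>.\<close>

lemma representation:
  obtains F :: "'v rad \<Rightarrow> exterior_op"
  where "is_ring_hom F" "\<And>i. i \<le> N \<Longrightarrow> F (vec i) = vmult_op N i"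
    "\<And>A. A \<in> SA \<Longrightarrow> F (ev A) = scale_op A"
proof -
  define ix where "ix v = (if v = x then 0 else inv_into {1..N} y v)" for v
  have ix: "ix v \<le> N" for v
    using bij_betw_apply[OF bij_betw_inv_into[OF bij], of v] by (auto simp: ix_def)
  have \<phi>: "is_ring_hom (\<lambda>c. scale_op (sconst c))"
    using scale_op_hom sconst_hom by (simp add: is_ring_hom_def)
  obtain F :: "'v rad \<Rightarrow> exterior_op" where F: "is_ring_hom F"
    "\<And>c. F (radial_const c) = scale_op (sconst c)" "\<And>v. F (radial_var v) = vmult_op N (ix v)"
  proof (rule radial_hom_exists[OF \<phi>, of "\<lambda>v. vmult_op N (ix v)"])
    show "comm (anticomm (vmult_op N (ix u)) (vmult_op N (ix v))) (vmult_op N (ix w)) = 0" for u v w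
      by (simp add: comm_def anticomm_vmult_op ix scale_vmult_op)
  qed (auto simp: scale_vmult_op)
  have Fh: "F 1 = 1" "F (a + b) = F a + F b" "F (a * b) = F a * F b" for a b
    using F(1) by (simp_all add: is_ring_hom_def)
  have sh: "scale_op (A + B) = scale_op A + scale_op B" "scale_op (A * B) = scale_op A * scale_op B" for A B
    using scale_op_hom by (simp_all add: is_ring_hom_def)
  have Fv: "F (vec i) = vmult_op N i" if "i \<le> N" for i
  proof (cases "i = 0")
    case False
    then have "i \<in> {1..N}" using that by simp
    then have "y i \<noteq> x" "inv_into {1..N} y (y i) = i"
      using bij by (auto simp: bij_betw_def)
    then show ?thesis using False by (simp add: vec_def F ix_def)
  qed (simp add: vec_def F ix_def)
  have Fa: "F (anticomm (vec i) (vec j)) = scale_op (half_gram i j + half_gram i j)" if "i \<le> N" "j \<le> N" for i j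
    unfolding anticomm_vmult_op[OF that, symmetric] by (simp add: anticomm_def Fh Fv that)
  have "F (svar_value x y u) = scale_op (svariable u)" if "u \<in> svars N" for u
  proof (cases u)
    case R_var
    have "svar_value x y u = (1 / 2) *\<^sub>R anticomm (vec 0) (vec 0)"
      using ev_half_gram[of 0 0] by (simp add: R_var half_gram_def scalar_eval_svariable)
    then have "F (svar_value x y u) = scale_op (sconst (of_real (1 / 2)) * (half_gram 0 0 + half_gram 0 0))"
      by (simp only: scaleR_radial_def Fh F(2) Fa[of 0 0] sh le0)
    then show ?thesis by (simp only: distrib_left sconst_half_double) (simp add: half_gram_def R_var)
  next
    case (S_var i)
    then have i: "1 \<le> i" "i \<le> N" using that by (simp_all add: svars_simps)
    then have "svar_value x y u = anticomm (vec 0) (vec i)" by (simp add: S_var vec_def)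
    then show ?thesis using Fa[of 0 i] i by (simp add: half_gram_def sconst_half_double S_var del: of_real_divide)
  next
    case (C_var i j)
    then have i: "1 \<le> i" "i \<le> j" "j \<le> N" using that by (simp_all add: svars_simps)
    then have "svar_value x y u = anticomm (vec i) (vec j)" by (simp add: C_var vec_def)
    then show ?thesis using Fa[of i j] i by (simp add: half_gram_def sconst_half_double C_var del: of_real_divide)
  qed
  note Fs = this
  have "F (ev A) = scale_op A" if "A \<in> SA" for A
    using that by (induction rule: scalar_algebra_induct)
      (simp_all add: scalar_eval_sconst scalar_eval_add scalar_eval_svariable_mult F(2) Fh Fs sh)
  then show thesis using that F(1) Fv by blast
qed

section \<open>Independence and spanning of the wedges\<close>

definition combination :: "(nat set \<Rightarrow> spoly) \<Rightarrow> 'v rad" where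
  "combination A = (\<Sum>J\<in>Pow {0..N}. wedge_of J * ev (A J))"

text \<open>With \<open>i\<close> the largest index and \<open>K\<close> the rest, the product of
  the wedge over \<open>K\<close> with \<open>vec i\<close> is the wedge over \<open>J\<close> plus
  contractions, and \<open>vmult\<close> yields the basis element of \<open>J\<close> plus the same
  contractions. Since these involve subsets of \<open>K\<close>, the induction is on cardinality;
  they cancel on comparison.\<close>

lemma wedge_of_act:
  fixes F :: "'v rad \<Rightarrow> exterior_op"
  assumes hom: "is_ring_hom F" and Fv: "\<And>i. i \<le> N \<Longrightarrow> F (vec i) = vmult_op N i"
    and Fe: "\<And>A. A \<in> SA \<Longrightarrow> F (ev A) = scale_op A" and J: "J \<subseteq> {0..N}"
  shows "Rep_exterior_op (F (wedge_of J)) (\<lambda>K. if K = {} then 1 else 0) = (\<lambda>K. if K = J then 1 else 0)"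
  using J
proof (induction "card J" arbitrary: J rule: less_induct)
  case less
  let ?act = "\<lambda>a. Rep_exterior_op (F a) (\<lambda>K. if K = {} then 1 else 0)"
  have Fh: "F 1 = 1" "F (a + b) = F a + F b" "F (a * b) = F a * F b" for a b
    using hom by (simp_all add: is_ring_hom_def)
  have act: "?act (a + b) = ?act a + ?act b" "?act (a * b) = Rep_exterior_op (F b) (?act a)" "?act 0 = 0" for a b
    by (simp_all add: Fh Rep_exterior_op_simps is_ring_hom_0[OF hom])
  have act_sum: "?act (sum f K) L = (\<Sum>k\<in>K. ?act (f k) L)" for f :: "nat \<Rightarrow> 'v rad" and K L
    by (induction K rule: infinite_finite_induct) (simp_all add: act)
  have fin: "finite J" using less.prems finite_subset by blast
  show ?case
  proof (cases "J = {}")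
    case True
    have "wedge_of {} = 1" by (simp add: wedge_of_def wedge_def sign_id)
    then show ?thesis by (simp add: True Fh Rep_exterior_op_simps)
  next
    case False
    \<comment> \<open>Appending the maximum keeps the list sorted, and no index of \<open>J\<close>
      lies above it, so neither the wedge nor \<open>create\<close> picks up a sign.\<close>
    define i where "i = Max J"
    define K where "K = J - {i}"
    have iJ: "i \<in> J" using Max_in[OF fin False] by (simp add: i_def)
    then have i: "i \<le> N" using less.prems by auto
    have J: "J = insert i K" "i \<notin> K" using iJ by (auto simp: K_def)
    have lt: "k < i" if "k \<in> K" for k
      using Max_ge[OF fin, of k] that by (auto simp: K_def i_def)
    have finK: "finite K" and KN: "K \<subseteq> {0..N}" and cK: "card K < card J"
      using fin less.prems by (auto simp: K_def intro: card_Diff1_less iJ)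
    have "sorted_list_of_set (set (sorted_list_of_set K @ [i])) = sorted_list_of_set K @ [i]"
      by (rule sorted_list_of_set.idem_if_sorted_distinct) (use finK J lt in \<open>auto simp: sorted_append less_imp_le\<close>)
    then have "sorted_list_of_set K @ [i] = sorted_list_of_set J" using J finK by simp
    then have "wedge (map vec (sorted_list_of_set K @ [i])) = wedge_of J" by (simp only: wedge_of_def)
    then have eq: "wedge_of K * vec i = wedge_of J + (\<Sum>j\<in>K. wedge_of (K - {j}) * ev (wsign N j K * half_gram i j))"
      using wedge_of_mult[OF KN i] by simp
    have IH: "?act (wedge_of L) = (\<lambda>M. if M = L then 1 else 0)" if "L \<subseteq> K" for L
      by (rule less.hyps) (use that KN cK card_mono[OF finK that] in auto)
    have t: "?act (wedge_of (K - {j}) * ev (wsign N j K * half_gram i j)) M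
        = (if M = K - {j} then wsign N j K * half_gram i j else 0)" if "j \<in> K" for j M
    proof -
      have "j \<le> N" using that KN by auto
      then have "wsign N j K * half_gram i j \<in> SA" using i by (intro scalar_algebra_mult wsign_SA half_gram_SA)
      then show ?thesis by (simp add: act IH Fe Rep_exterior_op_simps)
    qed
    have "?act (wedge_of K * vec i) M = ?act (wedge_of J) M
        + (\<Sum>j\<in>K. if M = K - {j} then wsign N j K * half_gram i j else 0)" for M
      unfolding eq act(1) plus_fun_apply act_sum by (simp add: t)
    moreover have "?act (wedge_of K * vec i) M = (if M = J then 1 else 0)
        + (\<Sum>j\<in>K. if M = K - {j} then wsign N j K * half_gram i j else 0)" for M
    proof -
      have "create N i (\<lambda>M. if M = K then 1 else 0) M = (if M = J then 1 else 0)"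
      proof (cases "i \<in> M \<and> M - {i} = K")
        case True
        then have "M = J" using J by auto
        have "{k \<in> J. i < k \<and> k \<le> N} = {}" using J by (auto dest: lt)
        then have "wsign N i J = 1" by (simp only: wsign_def card.empty power_0)
        then show ?thesis using True \<open>M = J\<close> by (simp add: create_def)
      next
        case False
        then show ?thesis using J by (auto simp: create_def)
      qed
      moreover have "(\<Sum>k\<le>N. half_gram i k * annihilate N k (\<lambda>M. if M = K then 1 else 0) M)
          = (\<Sum>k\<in>K. half_gram i k * annihilate N k (\<lambda>M. if M = K then 1 else 0) M)"
        by (rule sum.mono_neutral_right) (use KN in \<open>auto simp: annihilate_def\<close>)
      moreover have "\<dots> = (\<Sum>j\<in>K. if M = K - {j} then wsign N j K * half_gram i j else 0)"
      proof (rule sum.cong[OF refl])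
        fix j assume j: "j \<in> K"
        then have "j \<le> N" using KN by auto
        then have "wsign N j (K - {j}) = wsign N j K" using j by (simp add: wsign_remove)
        moreover have "j \<notin> M \<and> insert j M = K \<longleftrightarrow> M = K - {j}" using j by auto
        ultimately show "half_gram i j * annihilate N j (\<lambda>M. if M = K then 1 else 0) M
            = (if M = K - {j} then wsign N j K * half_gram i j else 0)"
          using j by (auto simp: annihilate_def)
      qed
      ultimately show ?thesis
        by (simp add: act IH Fv[OF i] Rep_exterior_op_simps vmult_def)
    qed
    ultimately show ?thesis by (simp add: fun_eq_iff)
  qed
qed

text \<open>Acting on the vacuum, a combination returns its own coefficients.\<close>

lemma combination_inject:
  assumes A: "\<And>J. A J \<in> SA" and B: "\<And>J. B J \<in> SA" and eq: "combination A = combination B"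
    and J: "J \<subseteq> {0..N}"
  shows "A J = B J"
proof -
  obtain F where F: "is_ring_hom F" "\<And>i. i \<le> N \<Longrightarrow> F (vec i) = vmult_op N i"
    "\<And>A. A \<in> SA \<Longrightarrow> F (ev A) = scale_op A" using representation by blast
  let ?act = "\<lambda>a. Rep_exterior_op (F a) (\<lambda>K. if K = {} then 1 else 0)"
  have act: "?act (a + b) = ?act a + ?act b" "?act (a * b) = Rep_exterior_op (F b) (?act a)" "?act 0 = 0" for a b
    using F(1) by (simp_all add: is_ring_hom_def Rep_exterior_op_simps is_ring_hom_0)
  have act_sum: "?act (sum f K) L = (\<Sum>k\<in>K. ?act (f k) L)" for f :: "nat set \<Rightarrow> 'v rad" and K L
    by (induction K rule: infinite_finite_induct) (simp_all add: act)
  have coeff: "?act (combination A) J = A J" if "\<And>J. A J \<in> SA" for A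
  proof -
    have "?act (combination A) J = (\<Sum>K\<in>Pow {0..N}. if K = J then A K else 0)"
      unfolding combination_def act_sum
      by (intro sum.cong refl) (auto simp: act wedge_of_act[OF F] F(3) that Rep_exterior_op_simps)
    then show ?thesis using J by simp
  qed
  show ?thesis using coeff[of A, OF A] coeff[of B, OF B] by (simp add: eq)
qed

definition comb_set :: "'v rad set" where
  "comb_set = {combination A | A. \<forall>J. A J \<in> SA}"

lemma combination_add: "combination (\<lambda>J. A J + B J) = combination A + combination B"
  by (simp add: combination_def scalar_eval_add distrib_left sum.distrib)

lemma comb_setI: "(\<And>J. A J \<in> SA) \<Longrightarrow> combination A \<in> comb_set"
  by (auto simp: comb_set_def)

lemma comb_set_add:
  assumes "a \<in> comb_set" "b \<in> comb_set"
  shows "a + b \<in> comb_set"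
proof -
  obtain A B where A: "\<And>J. A J \<in> SA" "a = combination A" and B: "\<And>J. B J \<in> SA" "b = combination B"
    using assms by (auto simp: comb_set_def)
  show ?thesis unfolding A(2) B(2) combination_add[symmetric]
    by (intro comb_setI scalar_algebra_add A B)
qed

lemma combination_mult_ev:
  assumes "B \<in> SA"
  shows "combination A * ev B = combination (\<lambda>J. B * A J)"
proof -
  have "wedge_of J * ev (A J) * ev B = wedge_of J * ev (B * A J)" for J
    by (simp only: scalar_eval_mult[OF assms] mult.assoc scalar_eval_central[of x y B])
  then show ?thesis by (simp add: combination_def sum_distrib_right)
qed

lemma comb_set_mult_ev:
  assumes "a \<in> comb_set" "B \<in> SA"
  shows "a * ev B \<in> comb_set"
proof -
  obtain A where A: "\<And>J. A J \<in> SA" "a = combination A" using assms(1) by (auto simp: comb_set_def)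
  show ?thesis unfolding A(2) combination_mult_ev[OF assms(2)]
    by (intro comb_setI scalar_algebra_mult assms A)
qed

lemma combination_single:
  assumes "J \<subseteq> {0..N}"
  shows "combination (\<lambda>K. if K = J then A else 0) = wedge_of J * ev A"
proof -
  have "combination (\<lambda>K. if K = J then A else 0) = (\<Sum>K\<in>Pow {0..N}. if K = J then wedge_of J * ev A else 0)"
    unfolding combination_def by (intro sum.cong) (auto simp: scalar_eval_0)
  then show ?thesis using assms by simp
qed

lemma comb_set_0: "0 \<in> comb_set"
  using comb_setI[of "\<lambda>_. 0"] by (simp add: combination_def scalar_eval_0)

lemma comb_set_wedge_of: "J \<subseteq> {0..N} \<Longrightarrow> wedge_of J * ev A \<in> comb_set" if "A \<in> SA"
  using comb_setI[of "\<lambda>K. if K = J then A else 0"] that by (simp add: combination_single)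

lemma comb_set_uminus: "a \<in> comb_set \<Longrightarrow> - a \<in> comb_set"
  using comb_set_mult_ev[of a "- 1"] by (simp add: scalar_eval_uminus scalar_eval_1 scalar_algebra_uminus)

lemma comb_set_sum: "(\<And>k. k \<in> K \<Longrightarrow> f k \<in> comb_set) \<Longrightarrow> sum f K \<in> comb_set"
  by (induction K rule: infinite_finite_induct) (simp_all add: comb_set_0 comb_set_add)

lemma wedge_of_mult_vec_comb_set:
  assumes J: "J \<subseteq> {0..N}" and i: "i \<le> N"
  shows "wedge_of J * vec i \<in> comb_set"
proof -
  have w: "wedge_of K \<in> comb_set" if "K \<subseteq> {0..N}" for K
    using comb_set_wedge_of[OF scalar_algebra_1 that] by (simp add: scalar_eval_1)
  have "finite J" using J finite_subset by blast
  then have "wedge (map vec (sorted_list_of_set J @ [i])) \<in> comb_set"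
    using wedge_of_snoc[of J i] J i w[of "insert i J"] by (auto simp: comb_set_0 comb_set_uminus)
  moreover have "(\<Sum>j\<in>J. wedge_of (J - {j}) * ev (wsign N j J * half_gram i j)) \<in> comb_set"
    by (intro comb_set_sum comb_set_wedge_of scalar_algebra_mult wsign_SA half_gram_SA i) (use J in auto)
  ultimately show ?thesis unfolding wedge_of_mult[OF J i] by (rule comb_set_add)
qed

text \<open>The span is a right ideal; as it contains 1 it is everything. Leaving \<open>a\<close>
  arbitrary lets the product case go through as a(bc) = (ab)c.\<close>

lemma comb_set_mult: "a \<in> comb_set \<Longrightarrow> a * z \<in> comb_set"
proof (induction z arbitrary: a rule: radial_induct)
  case (var v)
  obtain i where i: "i \<le> N" "radial_var v = vec i" by (rule vec_surj)
  obtain A where A: "\<And>J. A J \<in> SA" "a = combination A" using var by (auto simp: comb_set_def)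
  have "wedge_of J * ev (A J) * vec i = wedge_of J * vec i * ev (A J)" for J
    by (simp add: mult.assoc scalar_eval_central)
  then have "a * radial_var v = (\<Sum>J\<in>Pow {0..N}. wedge_of J * vec i * ev (A J))"
    by (simp add: A(2) combination_def sum_distrib_right i(2))
  also have "\<dots> \<in> comb_set"
    by (intro comb_set_sum comb_set_mult_ev wedge_of_mult_vec_comb_set i A) auto
  finally show ?case .
next
  case (const c)
  have "sconst c \<in> SA" using scalar_algebra_sconst[OF scalar_algebra_1, of c N] by simp
  then show ?case using comb_set_mult_ev[OF const, of "sconst c"] by (simp add: scalar_eval_sconst)
next
  case (add b c)
  then show ?case by (simp add: distrib_left comb_set_add)
next
  case (mult b c)
  then show ?case by (simp flip: mult.assoc)
qed

lemma comb_set_UNIV: "z \<in> comb_set"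
proof -
  have "wedge_of {} = 1" by (simp add: wedge_of_def wedge_def sign_id)
  then have "1 \<in> comb_set"
    using comb_set_wedge_of[OF scalar_algebra_1, of "{}"] by (simp add: scalar_eval_1)
  from comb_set_mult[OF this, of z] show ?thesis by simp
qed

text \<open>Only the values at subsets of {0..N} are determined by \<open>z\<close>; at other index
  sets the choice merely guarantees a member of \<open>SA\<close>.\<close>

definition coef :: "'v rad \<Rightarrow> nat set \<Rightarrow> spoly" where
  "coef z = (SOME A. (\<forall>J. A J \<in> SA) \<and> z = combination A)"

lemma coef_SA: "coef z J \<in> SA" and combination_coef: "combination (coef z) = z"
proof -
  have "\<exists>A. (\<forall>J. A J \<in> SA) \<and> z = combination A" using comb_set_UNIV[of z] unfolding comb_set_def by blast
  then have c: "(\<forall>J. coef z J \<in> SA) \<and> z = combination (coef z)" unfolding coef_def by (rule someI_ex)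
  show "coef z J \<in> SA" using c by blast
  show "combination (coef z) = z" by (rule conjunct2[OF c, symmetric])
qed

lemma coef_combination: "(\<And>J. A J \<in> SA) \<Longrightarrow> J \<subseteq> {0..N} \<Longrightarrow> coef (combination A) J = A J"
  by (rule combination_inject) (simp_all add: coef_SA combination_coef)

lemma coef_add: "J \<subseteq> {0..N} \<Longrightarrow> coef (a + b) J = coef a J + coef b J"
  using coef_combination[of "\<lambda>J. coef a J + coef b J" J]
  by (simp add: combination_add combination_coef coef_SA scalar_algebra_add)

lemma coef_mult_ev: "J \<subseteq> {0..N} \<Longrightarrow> B \<in> SA \<Longrightarrow> coef (a * ev B) J = B * coef a J"
  using coef_combination[of "\<lambda>J. B * coef a J" J]
  by (simp add: combination_coef coef_SA scalar_algebra_mult flip: combination_mult_ev)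

lemma coef_wedge_of:
  "J \<subseteq> {0..N} \<Longrightarrow> K \<subseteq> {0..N} \<Longrightarrow> A \<in> SA \<Longrightarrow> coef (wedge_of J * ev A) K = (if K = J then A else 0)"
  using coef_combination[of "\<lambda>K. if K = J then A else 0" K] by (simp add: combination_single)

section \<open>Coordinates and the two summands\<close>

definition y_coef :: "'v rad \<Rightarrow> nat set \<Rightarrow> spoly" where
  "y_coef z I = coef z I"

definition xy_coef :: "'v rad \<Rightarrow> nat set \<Rightarrow> spoly" where
  "xy_coef z I = coef z (insert 0 I)"

lemma coef_index_subset:
  assumes "I \<subseteq> {1..N}"
  shows "I \<subseteq> {0..N}" "insert 0 I \<subseteq> {0..N}" "0 \<notin> I"
  using assms by auto

lemma y_coef_SA: "y_coef z I \<in> SA" and xy_coef_SA: "xy_coef z I \<in> SA"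
  by (simp_all add: y_coef_def xy_coef_def coef_SA)

lemma coef_decomposition:
  "(\<Sum>I\<in>Pow {1..N}. y_wedge y I * ev (y_coef z I)) + (\<Sum>I\<in>Pow {1..N}. xy_wedge x y I * ev (xy_coef z I)) = z"
proof -
  have e: "{0..N} = insert 0 {1..N}" by auto
  have "Pow {0..N} = Pow {1..N} \<union> insert 0 ` Pow {1..N}" unfolding e by (rule Pow_insert)
  moreover have "Pow {1..N} \<inter> insert 0 ` Pow {1..N} = {}" by auto
  moreover have "inj_on (insert 0) (Pow {1..N})"
  proof (rule inj_onI)
    fix I K assume "I \<in> Pow {1..N}" "K \<in> Pow {1..N}" "insert 0 I = insert 0 K"
    then show "I = K" using coef_index_subset(3)[of I] coef_index_subset(3)[of K] by (simp add: insert_ident)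
  qed
  ultimately have "(\<Sum>I\<in>Pow {1..N}. wedge_of I * ev (coef z I))
      + (\<Sum>I\<in>Pow {1..N}. wedge_of (insert 0 I) * ev (coef z (insert 0 I))) = z"
    using combination_coef[of z] by (simp add: combination_def sum.union_disjoint sum.reindex)
  then show ?thesis by (simp add: y_coef_def xy_coef_def y_wedge_eq xy_wedge_eq)
qed

lemma y_xy_coef_simps:
  assumes I: "I \<subseteq> {1..N}"
  shows "y_coef (a + b) I = y_coef a I + y_coef b I"
    "xy_coef (a + b) I = xy_coef a I + xy_coef b I"
    "B \<in> SA \<Longrightarrow> y_coef (a * ev B) I = B * y_coef a I"
    "B \<in> SA \<Longrightarrow> xy_coef (a * ev B) I = B * xy_coef a I"
  using coef_index_subset[OF I] by (simp_all add: y_coef_def xy_coef_def coef_add coef_mult_ev)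

lemma y_xy_coef_0:
  assumes I: "I \<subseteq> {1..N}"
  shows "y_coef 0 I = 0" "xy_coef 0 I = 0"
  using y_xy_coef_simps(1,2)[OF I, of 0 0] by simp_all

lemma y_xy_coef_basis:
  assumes I: "I \<subseteq> {1..N}" and K: "K \<subseteq> {1..N}" and A: "A \<in> SA"
  shows "y_coef (y_wedge y K * ev A) I = (if I = K then A else 0)"
    "xy_coef (y_wedge y K * ev A) I = 0"
    "y_coef (xy_wedge x y K * ev A) I = 0"
    "xy_coef (xy_wedge x y K * ev A) I = (if I = K then A else 0)"
  using coef_index_subset[OF I] coef_index_subset[OF K] A
  by (auto simp: y_coef_def xy_coef_def y_wedge_eq[OF K] xy_wedge_eq[OF K] coef_wedge_of insert_ident)

lemma y_xy_coef_sum: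
  assumes I: "I \<subseteq> {1..N}"
  shows "y_coef (sum f K) I = (\<Sum>k\<in>K. y_coef (f k) I)" "xy_coef (sum f K) I = (\<Sum>k\<in>K. xy_coef (f k) I)"
  by (induction K rule: infinite_finite_induct) (simp_all add: y_xy_coef_0[OF I] y_xy_coef_simps[OF I])

text \<open>Membership becomes vanishing of the opposite coordinates, so closure properties and
  directness of the sum reduce to identities between coefficients.\<close>

lemma Y_space_iff: "z \<in> Y_space x y N \<longleftrightarrow> (\<forall>I. I \<subseteq> {1..N} \<longrightarrow> xy_coef z I = 0)"
proof
  assume "z \<in> Y_space x y N"
  then show "\<forall>I. I \<subseteq> {1..N} \<longrightarrow> xy_coef z I = 0"
    by (auto simp: Y_space_def y_xy_coef_sum y_xy_coef_basis)
next
  assume "\<forall>I. I \<subseteq> {1..N} \<longrightarrow> xy_coef z I = 0"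
  then have "(\<Sum>I\<in>Pow {1..N}. y_wedge y I * ev (y_coef z I)) = z"
    using coef_decomposition[of z] by (simp add: scalar_eval_0)
  from this[symmetric] show "z \<in> Y_space x y N" using y_coef_SA unfolding Y_space_def by blast
qed

lemma X_space_iff: "z \<in> X_space x y N \<longleftrightarrow> (\<forall>I. I \<subseteq> {1..N} \<longrightarrow> y_coef z I = 0)"
proof
  assume "z \<in> X_space x y N"
  then show "\<forall>I. I \<subseteq> {1..N} \<longrightarrow> y_coef z I = 0"
    by (auto simp: X_space_def y_xy_coef_sum y_xy_coef_basis)
next
  assume "\<forall>I. I \<subseteq> {1..N} \<longrightarrow> y_coef z I = 0"
  then have "(\<Sum>I\<in>Pow {1..N}. xy_wedge x y I * ev (xy_coef z I)) = z"
    using coef_decomposition[of z] by (simp add: scalar_eval_0)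
  from this[symmetric] show "z \<in> X_space x y N" using xy_coef_SA unfolding X_space_def by blast
qed

lemma X_space_add: "a \<in> X_space x y N \<Longrightarrow> b \<in> X_space x y N \<Longrightarrow> a + b \<in> X_space x y N"
  and X_space_mult_ev: "a \<in> X_space x y N \<Longrightarrow> B \<in> SA \<Longrightarrow> a * ev B \<in> X_space x y N"
  and X_space_0: "0 \<in> X_space x y N"
  by (simp_all add: X_space_iff y_xy_coef_simps y_xy_coef_0)

lemma X_space_uminus: "a \<in> X_space x y N \<Longrightarrow> - a \<in> X_space x y N"
  using X_space_mult_ev[of a "- 1"] by (simp add: scalar_eval_uminus scalar_eval_1 scalar_algebra_uminus)

lemma X_space_sum: "(\<And>k. k \<in> K \<Longrightarrow> f k \<in> X_space x y N) \<Longrightarrow> sum f K \<in> X_space x y N"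
  by (induction K rule: infinite_finite_induct) (simp_all add: X_space_0 X_space_add)

lemma X_space_basis: "K \<subseteq> {1..N} \<Longrightarrow> A \<in> SA \<Longrightarrow> xy_wedge x y K * ev A \<in> X_space x y N"
  by (simp add: X_space_iff y_xy_coef_basis)

lemma Y_space_basis: "K \<subseteq> {1..N} \<Longrightarrow> A \<in> SA \<Longrightarrow> y_wedge y K * ev A \<in> Y_space x y N"
  by (simp add: Y_space_iff y_xy_coef_basis)

lemma Y_space_add: "a \<in> Y_space x y N \<Longrightarrow> b \<in> Y_space x y N \<Longrightarrow> a + b \<in> Y_space x y N"
  and Y_space_0: "0 \<in> Y_space x y N"
  by (simp_all add: Y_space_iff y_xy_coef_simps y_xy_coef_0)

lemma Y_space_sum: "(\<And>k. k \<in> K \<Longrightarrow> f k \<in> Y_space x y N) \<Longrightarrow> sum f K \<in> Y_space x y N"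
  by (induction K rule: infinite_finite_induct) (simp_all add: Y_space_0 Y_space_add)

section \<open>Operators determined by their values on the basis\<close>

definition extend ::
  "(nat set \<Rightarrow> spoly \<Rightarrow> 'v rad) \<Rightarrow> (nat set \<Rightarrow> spoly \<Rightarrow> 'v rad) \<Rightarrow> 'v rad \<Rightarrow> 'v rad" where
  "extend P R z = (\<Sum>I\<in>Pow {1..N}. P I (y_coef z I)) + (\<Sum>I\<in>Pow {1..N}. R I (xy_coef z I))"

text \<open>The uniqueness half for the operators given on the whole algebra by a definite
  description; \<open>extend_props\<close> is the existence half. Additivity suffices because
  arbitrary scalar coefficients are part of the prescribed values.\<close>

lemma extend_unique:
  assumes D: "additive D"
    and y: "\<And>I A. I \<subseteq> {1..N} \<Longrightarrow> A \<in> SA \<Longrightarrow> D (y_wedge y I * ev A) = P I A"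
    and xy: "\<And>I A. I \<subseteq> {1..N} \<Longrightarrow> A \<in> SA \<Longrightarrow> D (xy_wedge x y I * ev A) = R I A"
  shows "D = extend P R"
proof
  fix z
  have "D z = D ((\<Sum>I\<in>Pow {1..N}. y_wedge y I * ev (y_coef z I)) + (\<Sum>I\<in>Pow {1..N}. xy_wedge x y I * ev (xy_coef z I)))"
    by (simp only: coef_decomposition)
  also have "\<dots> = extend P R z"
    unfolding extend_def additive.add[OF D] additive.sum[OF D]
    by (intro arg_cong2[of _ _ _ _ "(+)"] sum.cong refl) (simp_all add: y xy y_coef_SA xy_coef_SA)
  finally show "D z = extend P R z" .
qed

lemma extend_props:
  assumes P: "\<And>I A B. P I (A + B) = P I A + P I B" and R: "\<And>I A B. R I (A + B) = R I A + R I B"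
  shows "additive (extend P R)"
    and "\<And>I A. I \<subseteq> {1..N} \<Longrightarrow> A \<in> SA \<Longrightarrow> extend P R (y_wedge y I * ev A) = P I A"
    and "\<And>I A. I \<subseteq> {1..N} \<Longrightarrow> A \<in> SA \<Longrightarrow> extend P R (xy_wedge x y I * ev A) = R I A"
proof -
  \<comment> \<open>These zeros remove the summands belonging to all other basis elements.\<close>
  have z: "P I 0 = 0" "R I 0 = 0" for I using P[of I 0 0] R[of I 0 0] by simp_all
  show "additive (extend P R)"
    by (simp add: additive_def extend_def y_xy_coef_simps P R sum.distrib algebra_simps)
  fix I A assume I: "I \<subseteq> {1..N}" and A: "A \<in> SA"
  have "(\<Sum>K\<in>Pow {1..N}. P K (y_coef (y_wedge y I * ev A) K)) = (\<Sum>K\<in>Pow {1..N}. if K = I then P I A else 0)"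
    by (intro sum.cong) (use I A in \<open>auto simp: y_xy_coef_basis z\<close>)
  then show "extend P R (y_wedge y I * ev A) = P I A"
    using I A by (simp add: extend_def y_xy_coef_basis z)
  have "(\<Sum>K\<in>Pow {1..N}. R K (xy_coef (xy_wedge x y I * ev A) K)) = (\<Sum>K\<in>Pow {1..N}. if K = I then R I A else 0)"
    by (intro sum.cong) (use I A in \<open>auto simp: y_xy_coef_basis z\<close>)
  then show "extend P R (xy_wedge x y I * ev A) = R I A"
    using I A by (simp add: extend_def y_xy_coef_basis z)
qed

text \<open>For \<open>d_R\<close>, whose description asks for linearity over the coefficients and
  not just additivity.\<close>

lemma extend_scale:
  assumes "\<And>I A. P I (sconst c * A) = radial_const c * P I A"
    and "\<And>I A. R I (sconst c * A) = radial_const c * R I A"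
  shows "extend P R (radial_const c * a) = radial_const c * extend P R a"
proof -
  have "y_coef (radial_const c * a) I = sconst c * y_coef a I"
    "xy_coef (radial_const c * a) I = sconst c * xy_coef a I" if "I \<subseteq> {1..N}" for I
    using y_xy_coef_simps(3,4)[OF that, of "sconst c" a] scalar_algebra_sconst[OF scalar_algebra_1, of c N]
    by (simp_all add: scalar_eval_sconst radial_const_central)
  then show ?thesis
    unfolding extend_def distrib_left sum_distrib_left
    by (intro arg_cong2[of _ _ _ _ "(+)"] sum.cong refl) (simp_all only: assms Pow_iff)
qed

lemma creation_eq: "creation x y N = extend (\<lambda>I A. xy_wedge x y I * ev A) (\<lambda>I A. 0)" (is "_ = ?E")
  unfolding creation_def
proof (rule the_equality)
  show "additive ?E \<and> (\<forall>I A. I \<subseteq> {1..N} \<longrightarrow> A \<in> SA \<longrightarrow>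
      ?E (y_wedge y I * ev A) = xy_wedge x y I * ev A \<and> ?E (xy_wedge x y I * ev A) = 0)"
    using extend_props[of "\<lambda>I A. xy_wedge x y I * ev A" "\<lambda>I A. 0"]
    by (simp add: scalar_eval_add distrib_left)
qed (rule extend_unique; blast)

lemma Delta_sum_eq: "Delta_sum x y N = extend (\<lambda>I A. y_wedge y I * ev (Delta N (card I) A))
    (\<lambda>I A. xy_wedge x y I * ev (Delta N (card I) A))" (is "_ = ?E")
  unfolding Delta_sum_def
proof (rule the_equality)
  show "additive ?E \<and> (\<forall>I A. I \<subseteq> {1..N} \<longrightarrow> A \<in> SA \<longrightarrow>
      ?E (y_wedge y I * ev A) = y_wedge y I * ev (Delta N (card I) A) \<and>
      ?E (xy_wedge x y I * ev A) = xy_wedge x y I * ev (Delta N (card I) A))"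
    using extend_props[of "\<lambda>I A. y_wedge y I * ev (Delta N (card I) A)"
        "\<lambda>I A. xy_wedge x y I * ev (Delta N (card I) A)"]
    by (simp add: scalar_eval_add Delta_add distrib_left)
qed (rule extend_unique; blast)

section \<open>The scalar derivative by components and the Euler operator\<close>

definition grad_coef :: "nat \<Rightarrow> spoly \<Rightarrow> spoly" where
  "grad_coef i A = (if i = 0 then sconst (1 + q_B) * jackson R_var (q_B ^ 2) A
     else 2 * q_shift R_var (q_B ^ 2) (jackson (S_var i) q_B A))"

lemma atMost_eq_insert: "{..N} = insert 0 {1..N}"
  by auto

lemma scalar_eval_two_mult: "ev (2 * A) = 2 * ev A"
  by (simp only: mult_2 scalar_eval_add)

lemma d_sc_eq: "d_sc x y N A = (\<Sum>i\<le>N. vec i * ev (grad_coef i A))"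
proof -
  have "radial_const c * a * b = a * (radial_const c * b)" for a b :: "'v rad" and c
    by (simp only: mult.assoc[symmetric] radial_const_central[of c a])
  moreover have "2 * (\<Sum>i=1..N. radial_var (y i) * ev (f i)) = (\<Sum>i=1..N. vec i * (2 * ev (f i)))" for f
    unfolding mult_2 distrib_left sum.distrib by (simp add: vec_def)
  ultimately show ?thesis
    by (simp add: d_sc_def atMost_eq_insert grad_coef_def scalar_eval_sconst_mult vec_def scalar_eval_two_mult
        del: One_nat_def)
qed

text \<open>Contracting x with the scalar derivative gives the Euler operator: the factor 2 in
  \<open>grad_coef\<close> cancels the 1/2 of \<open>half_gram\<close>, and multiplication by s_i
  passes through the shift in r.\<close>

lemma E_sc_eq: "E_sc N A = (\<Sum>i\<le>N. half_gram i 0 * grad_coef i A)"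
proof -
  have h: "sconst (of_real (1 / 2)) * S * (2 * T) = S * T" for S T
    using sconst_half_double[of "S * T"] by (simp only: mult_2 distrib_left mult.assoc)
  have "half_gram i 0 * grad_coef i A = q_shift R_var (q_B ^ 2) (svariable (S_var i) * jackson (S_var i) q_B A)"
    if "i \<in> {1..N}" for i
    using that by (simp add: half_gram_def grad_coef_def h q_shift_svariable del: of_real_divide)
  moreover have "half_gram 0 0 * grad_coef 0 A = sconst (1 + q_B) * svariable R_var * jackson R_var (q_B ^ 2) A"
    by (simp add: half_gram_def grad_coef_def mult_ac)
  ultimately show ?thesis
    by (simp add: E_sc_def atMost_eq_insert q_shift_sum del: One_nat_def)
qed

lemma grad_coef_SA:
  assumes A: "A \<in> SA"
  shows "grad_coef i A \<in> SA"
proof -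
  have "sconst (1 + q_B) * jackson R_var (q_B ^ 2) A \<in> SA"
    by (intro scalar_algebra_sconst scalar_algebra_jackson q_B_neq A)
  moreover have "2 * q_shift R_var (q_B ^ 2) (jackson (S_var i) q_B A) \<in> SA"
    unfolding mult_2
    by (intro scalar_algebra_add scalar_algebra_q_shift scalar_algebra_jackson q_B_neq A)
  ultimately show ?thesis by (simp add: grad_coef_def)
qed

lemma grad_coef_add: "grad_coef i (A + B) = grad_coef i A + grad_coef i B"
  by (simp add: grad_coef_def jackson_simps q_shift_add distrib_left)

lemma grad_coef_sconst: "grad_coef i (sconst c * A) = sconst c * grad_coef i A"
  by (simp add: grad_coef_def jackson_simps q_shift_sconst mult.left_commute)

lemma d_sc_add: "d_sc x y N (A + B) = d_sc x y N A + d_sc x y N B"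
  by (simp add: d_sc_eq grad_coef_add scalar_eval_add distrib_left sum.distrib)

lemma radial_const_left_commute: "a * (radial_const c * b) = radial_const c * (a * b)"
  by (simp only: mult.assoc[symmetric] radial_const_central[of c a])

lemma d_sc_sconst: "d_sc x y N (sconst c * A) = radial_const c * d_sc x y N A"
  by (simp add: d_sc_eq grad_coef_sconst scalar_eval_sconst_mult sum_distrib_left radial_const_left_commute)

lemma d_R_eq: "d_R x y N = extend (\<lambda>I A. y_wedge y I * d_sc x y N A)
    (\<lambda>I B. (- 1) ^ card I * radial_const (q_num_m (- int (card I))) * y_wedge y I * ev B
          + radial_const (q_pow_m (- int (card I))) * xy_wedge x y I * d_sc x y N B)"
  (is "_ = extend ?P ?R")
  unfolding d_R_def
proof (rule the_equality)
  let ?s = "\<lambda>c a. radial_const c * a :: 'v rad"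
  have add: "?P I (A + B) = ?P I A + ?P I B" "?R I (A + B) = ?R I A + ?R I B" for I A B
    by (simp_all add: d_sc_add scalar_eval_add distrib_left)
  have sc: "?P I (sconst c * A) = radial_const c * ?P I A" "?R I (sconst c * A) = radial_const c * ?R I A" for I c A
    by (simp_all add: d_sc_sconst scalar_eval_sconst_mult radial_const_left_commute distrib_left)
  have m: "Modules.module ?s"
    by standard (simp_all add: radial_const_simps distrib_left distrib_right mult.assoc)
  note p = extend_props[of ?P ?R, OF add]
  have "extend ?P ?R (radial_const c * a) = radial_const c * extend ?P ?R a" for c a
    by (rule extend_scale[of ?P _ ?R, OF sc])
  then have "module_hom ?s ?s (extend ?P ?R)"
    using m p(1) by (simp add: module_hom_def module_hom_axioms_def additive_def)
  then show "module_hom ?s ?s (extend ?P ?R) \<and>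
     (\<forall>I A. I \<subseteq> {1..N} \<longrightarrow> A \<in> SA \<longrightarrow> extend ?P ?R (y_wedge y I * ev A) = ?P I A) \<and>
     (\<forall>I B. I \<subseteq> {1..N} \<longrightarrow> B \<in> SA \<longrightarrow> extend ?P ?R (xy_wedge x y I * ev B) = ?R I B)"
    using p(2,3) by blast
next
  fix D assume D: "module_hom (\<lambda>c a. radial_const c * a) (\<lambda>c a. radial_const c * a) D \<and>
     (\<forall>I A. I \<subseteq> {1..N} \<longrightarrow> A \<in> SA \<longrightarrow> D (y_wedge y I * ev A) = ?P I A) \<and>
     (\<forall>I B. I \<subseteq> {1..N} \<longrightarrow> B \<in> SA \<longrightarrow> D (xy_wedge x y I * ev B) = ?R I B)"
  then have "additive D" by (simp add: module_hom_def module_hom_axioms_def additive_def)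
  then show "D = extend ?P ?R" by (rule extend_unique) (use D in blast)+
qed

text \<open>Appending a vector or contracting one of the y_j keeps the index 0, so these terms stay
  in the X-part. Only the contraction of x itself leaves it, with sign (-1)^p because all of
  \<open>I\<close> lies above 0.\<close>

lemma xy_wedge_mult_vec:
  assumes I: "I \<subseteq> {1..N}" and i: "i \<le> N"
  obtains w where "w \<in> X_space x y N"
    "xy_wedge x y I * vec i = y_wedge y I * ev ((- 1) ^ card I * half_gram i 0) + w"
proof -
  let ?J = "insert 0 I"
  note J = coef_index_subset[OF I]
  have fin: "finite I" using I finite_subset by blast
  define w where "w = wedge (map vec (sorted_list_of_set ?J @ [i])) +
    (\<Sum>j\<in>I. wedge_of (?J - {j}) * ev (wsign N j ?J * half_gram i j))"
  have b: "wedge_of (insert 0 K) * ev A \<in> X_space x y N" if "K \<subseteq> {1..N}" "A \<in> SA" for K A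
    using X_space_basis[OF that] by (simp only: xy_wedge_eq[OF that(1)])
  have b1: "wedge_of (insert i ?J) \<in> X_space x y N" if "i \<notin> ?J"
    using b[of "insert i I" 1] that I i by (simp add: scalar_eval_1 insert_commute)
  have "wedge (map vec (sorted_list_of_set ?J @ [i])) \<in> X_space x y N"
    using wedge_of_snoc[of ?J i] fin b1 by (auto simp: X_space_0 X_space_uminus)
  moreover have "wedge_of (?J - {j}) * ev (wsign N j ?J * half_gram i j) \<in> X_space x y N" if "j \<in> I" for j
  proof -
    have "?J - {j} = insert 0 (I - {j})" "j \<le> N" using that J I by auto
    then show ?thesis using I i by (auto intro!: b scalar_algebra_mult wsign_SA half_gram_SA)
  qed
  ultimately have "w \<in> X_space x y N" unfolding w_def by (intro X_space_add X_space_sum)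
  moreover have "{k \<in> ?J. 0 < k \<and> k \<le> N} = I" using I by auto
  then have "wsign N 0 ?J = (- 1) ^ card I" by (simp add: wsign_def)
  then have "xy_wedge x y I * vec i = y_wedge y I * ev ((- 1) ^ card I * half_gram i 0) + w"
    unfolding xy_wedge_eq[OF I] y_wedge_eq[OF I] wedge_of_mult[OF J(2) i]
    using fin J(3) by (simp add: w_def)
  ultimately show thesis by (rule that)
qed

lemma xy_wedge_mult_d_sc:
  assumes I: "I \<subseteq> {1..N}" and A: "A \<in> SA"
  obtains w where "w \<in> X_space x y N"
    "xy_wedge x y I * d_sc x y N A = y_wedge y I * ev ((- 1) ^ card I * E_sc N A) + w"
proof -
  have "\<exists>w. w \<in> X_space x y N \<and> xy_wedge x y I * vec i = y_wedge y I * ev ((- 1) ^ card I * half_gram i 0) + w"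
    if "i \<le> N" for i using xy_wedge_mult_vec[OF I that] by blast
  then obtain w where w: "\<And>i. i \<le> N \<Longrightarrow> w i \<in> X_space x y N"
    "\<And>i. i \<le> N \<Longrightarrow> xy_wedge x y I * vec i = y_wedge y I * ev ((- 1) ^ card I * half_gram i 0) + w i"
    by metis
  have "xy_wedge x y I * d_sc x y N A = (\<Sum>i\<le>N. xy_wedge x y I * vec i * ev (grad_coef i A))"
    by (simp add: d_sc_eq sum_distrib_left mult.assoc)
  also have "\<dots> = (\<Sum>i\<le>N. y_wedge y I * ev ((- 1) ^ card I * (half_gram i 0 * grad_coef i A)) + w i * ev (grad_coef i A))"
    by (intro sum.cong refl)
      (simp add: w(2) distrib_right mult.assoc scalar_eval_minus_one_power scalar_eval_mult[OF half_gram_SA])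
  also have "\<dots> = y_wedge y I * ev ((- 1) ^ card I * E_sc N A) + (\<Sum>i\<le>N. w i * ev (grad_coef i A))"
    by (simp add: E_sc_eq sum_distrib_left sum.distrib scalar_eval_sum)
  finally show thesis
    by (rule that[rotated]) (intro X_space_sum X_space_mult_ev w grad_coef_SA A; simp)
qed

section \<open>The anticommutator on basis elements\<close>

lemma creation_X_space: "w \<in> X_space x y N \<Longrightarrow> creation x y N w = 0"
  by (simp add: creation_eq extend_def X_space_iff scalar_eval_0)

lemma creation_in_X_space: "creation x y N z \<in> X_space x y N"
  unfolding creation_eq extend_def
  by (intro X_space_add X_space_sum X_space_basis y_coef_SA X_space_0) auto

lemma creation_add: "creation x y N (a + b) = creation x y N a + creation x y N b"
  and creation_y: "I \<subseteq> {1..N} \<Longrightarrow> A \<in> SA \<Longrightarrow> creation x y N (y_wedge y I * ev A) = xy_wedge x y I * ev A"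
  and creation_xy: "I \<subseteq> {1..N} \<Longrightarrow> A \<in> SA \<Longrightarrow> creation x y N (xy_wedge x y I * ev A) = 0"
  using extend_props[of "\<lambda>I A. xy_wedge x y I * ev A" "\<lambda>I A. 0"]
  by (simp_all add: creation_eq scalar_eval_add distrib_left additive_def)

lemma d_R_add: "d_R x y N (a + b) = d_R x y N a + d_R x y N b"
  and d_R_y: "I \<subseteq> {1..N} \<Longrightarrow> A \<in> SA \<Longrightarrow> d_R x y N (y_wedge y I * ev A) = y_wedge y I * d_sc x y N A"
  and d_R_xy: "I \<subseteq> {1..N} \<Longrightarrow> A \<in> SA \<Longrightarrow> d_R x y N (xy_wedge x y I * ev A) =
     (- 1) ^ card I * radial_const (q_num_m (- int (card I))) * y_wedge y I * ev A
          + radial_const (q_pow_m (- int (card I))) * xy_wedge x y I * d_sc x y N A"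
proof -
  let ?P = "\<lambda>I A. y_wedge y I * d_sc x y N A"
  let ?R = "\<lambda>I B. (- 1) ^ card I * radial_const (q_num_m (- int (card I))) * y_wedge y I * ev B
          + radial_const (q_pow_m (- int (card I))) * xy_wedge x y I * d_sc x y N B"
  have add: "?P I (A + B) = ?P I A + ?P I B" "?R I (A + B) = ?R I A + ?R I B" for I A B
    by (simp_all add: d_sc_add scalar_eval_add distrib_left)
  note p = extend_props[of ?P ?R, OF add]
  show "d_R x y N (a + b) = d_R x y N a + d_R x y N b" using p(1) by (simp add: d_R_eq additive_def)
  show "I \<subseteq> {1..N} \<Longrightarrow> A \<in> SA \<Longrightarrow> d_R x y N (y_wedge y I * ev A) = y_wedge y I * d_sc x y N A"
    unfolding d_R_eq by (rule p(2))
  show "I \<subseteq> {1..N} \<Longrightarrow> A \<in> SA \<Longrightarrow> d_R x y N (xy_wedge x y I * ev A) = ?R I A"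
    unfolding d_R_eq by (rule p(3))
qed

lemma scaled_basis:
  "(- 1) ^ p * radial_const c * b * ev A = b * ev ((- 1) ^ p * (sconst c * A))"
  "radial_const c * (b * ev A) = b * ev (sconst c * A)"
proof -
  show e: "radial_const c * (b * ev A) = b * ev (sconst c * A)" for c b A
    by (simp add: scalar_eval_sconst_mult radial_const_left_commute)
  have "(- 1) ^ p * radial_const c * b * ev A = (- 1) ^ p * (b * ev (sconst c * A))"
    by (simp add: mult.assoc e)
  also have "\<dots> = b * ev ((- 1) ^ p * (sconst c * A))"
    by (metis mult.assoc minus_one_power_commute scalar_eval_minus_one_power)
  finally show "(- 1) ^ p * radial_const c * b * ev A = b * ev ((- 1) ^ p * (sconst c * A))" .
qed

text \<open>Creation annihilates the argument, so only creation after the derivative remains. It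
  also discards the X-part \<open>w\<close> of the derivative, leaving exactly the scalar factor of
  the Y-component, which is \<open>Delta\<close>.\<close>

lemma H_op_xy:
  assumes I: "I \<subseteq> {1..N}" and A: "A \<in> SA"
  shows "H_op x y N (xy_wedge x y I * ev A) = xy_wedge x y I * ev (Delta N (card I) A)"
proof -
  let ?p = "card I" and ?n = "q_num_m (- int (card I))" and ?c = "q_pow_m (- int (card I))"
  obtain w where w: "w \<in> X_space x y N"
    "xy_wedge x y I * d_sc x y N A = y_wedge y I * ev ((- 1) ^ ?p * E_sc N A) + w"
    by (rule xy_wedge_mult_d_sc[OF I A])
  have cw: "radial_const ?c * w \<in> X_space x y N"
    using X_space_mult_ev[OF w(1), of "sconst ?c"] scalar_algebra_sconst[OF scalar_algebra_1, of ?c N]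
    by (simp add: scalar_eval_sconst radial_const_central)
  have S: "(- 1) ^ ?p * (sconst ?n * A) \<in> SA" "sconst ?c * ((- 1) ^ ?p * E_sc N A) \<in> SA"
    by (intro scalar_algebra_minus_one_power scalar_algebra_sconst E_sc_scalar_algebra A)+
  have dR: "d_R x y N (xy_wedge x y I * ev A) = y_wedge y I * ev ((- 1) ^ ?p * (sconst ?n * A))
      + (y_wedge y I * ev (sconst ?c * ((- 1) ^ ?p * E_sc N A)) + radial_const ?c * w)"
    by (simp only: d_R_xy[OF I A] scaled_basis(1)) (simp only: mult.assoc w(2) distrib_left scaled_basis(2))
  have "d_R x y N 0 = 0" using d_R_add[of 0 0] by simp
  then have "H_op x y N (xy_wedge x y I * ev A) = creation x y N (y_wedge y I * ev ((- 1) ^ ?p * (sconst ?n * A))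
      + (y_wedge y I * ev (sconst ?c * ((- 1) ^ ?p * E_sc N A)) + radial_const ?c * w))"
    by (simp add: H_op_def creation_xy[OF I A] dR)
  also have "\<dots> = xy_wedge x y I * ev ((- 1) ^ ?p * (sconst ?n * A) + sconst ?c * ((- 1) ^ ?p * E_sc N A))"
    by (simp only: creation_add creation_y[OF I] S creation_X_space[OF cw] scalar_eval_add distrib_left) simp
  also have "\<dots> = xy_wedge x y I * ev (Delta N ?p A)"
    by (simp add: Delta_def distrib_left mult.left_commute)
  finally show ?thesis .
qed

text \<open>A regrouping: the term with \<open>E_sc\<close> is added to complete
  \<open>Delta\<close> and subtracted again inside \<open>N_part\<close>. The real content is that
  the remainder lies in the X-part.\<close>

lemma H_op_y:
  assumes I: "I \<subseteq> {1..N}" and A: "A \<in> SA"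
  shows "H_op x y N (y_wedge y I * ev A) = y_wedge y I * ev (Delta N (card I) A) + N_part x y N I A"
proof -
  let ?n = "radial_const (q_num_m (- int (card I)))" and ?c = "radial_const (q_pow_m (- int (card I)))"
  have Delta: "y_wedge y I * ev (Delta N (card I) A)
      = (- 1) ^ card I * ?n * y_wedge y I * ev A + (- 1) ^ card I * ?c * y_wedge y I * ev (E_sc N A)"
    by (simp only: Delta_def scaled_basis(1) distrib_left scalar_eval_add)
  have alg: "a + b + c = (a + d) + (b + c - d)" for a b c d :: "'v rad" by simp
  show ?thesis
    unfolding H_op_def creation_y[OF I A] d_R_y[OF I A] d_R_xy[OF I A] N_part_def Delta by (rule alg)
qed

text \<open>The subtracted term is precisely the Y-component of the scaled product of x \<and> y_I
  with the scalar derivative, and creation takes values in the X-part.\<close>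

lemma N_part_X_space:
  assumes I: "I \<subseteq> {1..N}" and A: "A \<in> SA"
  shows "N_part x y N I A \<in> X_space x y N"
proof -
  let ?p = "card I" and ?c = "q_pow_m (- int (card I))"
  obtain w where w: "w \<in> X_space x y N"
    "xy_wedge x y I * d_sc x y N A = y_wedge y I * ev ((- 1) ^ ?p * E_sc N A) + w"
    by (rule xy_wedge_mult_d_sc[OF I A])
  have cw: "radial_const ?c * w \<in> X_space x y N"
    using X_space_mult_ev[OF w(1), of "sconst ?c"] scalar_algebra_sconst[OF scalar_algebra_1, of ?c N]
    by (simp add: scalar_eval_sconst radial_const_central)
  have "radial_const ?c * xy_wedge x y I * d_sc x y N A
      = y_wedge y I * ev ((- 1) ^ ?p * (sconst ?c * E_sc N A)) + radial_const ?c * w"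
    by (simp add: mult.assoc w(2) distrib_left scaled_basis(2) mult.left_commute)
  then have "N_part x y N I A = radial_const ?c * w + creation x y N (y_wedge y I * d_sc x y N A)"
    by (simp add: N_part_def scaled_basis(1))
  then show ?thesis by (simp add: X_space_add cw creation_in_X_space)
qed

section \<open>The operator N and the block matrix\<close>

lemma N_part_add: "N_part x y N I (A + B) = N_part x y N I A + N_part x y N I B"
  by (simp add: N_part_def d_sc_add E_sc_add scalar_eval_add distrib_left creation_add)

text \<open>The description of \<open>N_op\<close> asks for an extensional function on the Y-part,
  so the candidate is a restricted \<open>extend\<close>, undefined outside that part.\<close>

lemma N_op_props:
  shows "N_op x y N = restrict (extend (N_part x y N) (\<lambda>I A. 0)) (Y_space x y N)"
    and "restrict (extend (N_part x y N) (\<lambda>I A. 0)) (Y_space x y N) \<in> Y_space x y N \<rightarrow> X_space x y N"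
    and "\<And>I A. I \<subseteq> {1..N} \<Longrightarrow> A \<in> SA \<Longrightarrow>
      restrict (extend (N_part x y N) (\<lambda>I A. 0)) (Y_space x y N) (y_wedge y I * ev A) = N_part x y N I A"
proof -
  let ?E = "extend (N_part x y N) (\<lambda>I A. 0)"
  let ?F = "restrict ?E (Y_space x y N)"
  have p: "additive ?E" "\<And>I A. I \<subseteq> {1..N} \<Longrightarrow> A \<in> SA \<Longrightarrow> ?E (y_wedge y I * ev A) = N_part x y N I A"
    by (rule extend_props; simp add: N_part_add)+
  have X: "?E z \<in> X_space x y N" for z
    unfolding extend_def by (intro X_space_add X_space_sum N_part_X_space X_space_0 y_coef_SA) auto
  then show "?F \<in> Y_space x y N \<rightarrow> X_space x y N" by auto
  show F: "?F (y_wedge y I * ev A) = N_part x y N I A" if "I \<subseteq> {1..N}" "A \<in> SA" for I A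
    using that by (simp add: Y_space_basis p(2))
  show "N_op x y N = ?F"
    unfolding N_op_def
  proof (rule the_equality)
    show "?F \<in> Y_space x y N \<rightarrow>\<^sub>E X_space x y N \<and>
     (\<forall>u\<in>Y_space x y N. \<forall>w\<in>Y_space x y N. ?F (u + w) = ?F u + ?F w) \<and>
     (\<forall>I A. I \<subseteq> {1..N} \<longrightarrow> A \<in> SA \<longrightarrow> ?F (y_wedge y I * ev A) = N_part x y N I A)"
      using X F p(1) by (auto simp: Y_space_add additive_def)
  next
    fix G assume G: "G \<in> Y_space x y N \<rightarrow>\<^sub>E X_space x y N \<and>
     (\<forall>u\<in>Y_space x y N. \<forall>w\<in>Y_space x y N. G (u + w) = G u + G w) \<and>
     (\<forall>I A. I \<subseteq> {1..N} \<longrightarrow> A \<in> SA \<longrightarrow> G (y_wedge y I * ev A) = N_part x y N I A)"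
    \<comment> \<open>A competitor is additive only within the Y-part, so
      \<open>extend_unique\<close> does not apply; the additivity argument is repeated with every
      partial sum kept in that part.\<close>
    have G0: "G 0 = 0" using G Y_space_0 by (metis add_cancel_right_right)
    have Gsum: "G (sum f K) = (\<Sum>k\<in>K. G (f k))" if "\<And>k. k \<in> K \<Longrightarrow> f k \<in> Y_space x y N" for f :: "nat set \<Rightarrow> 'v rad" and K
      using that by (induction K rule: infinite_finite_induct) (simp_all add: G0 G Y_space_sum)
    show "G = ?F"
    proof
      fix z
      show "G z = ?F z"
      proof (cases "z \<in> Y_space x y N")
        case True
        then have z: "(\<Sum>I\<in>Pow {1..N}. y_wedge y I * ev (y_coef z I)) = z"
          using coef_decomposition[of z] by (simp add: Y_space_iff scalar_eval_0)
        have "G (\<Sum>I\<in>Pow {1..N}. y_wedge y I * ev (y_coef z I)) = (\<Sum>I\<in>Pow {1..N}. G (y_wedge y I * ev (y_coef z I)))"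
          by (rule Gsum) (auto simp del: One_nat_def intro!: Y_space_basis y_coef_SA)
        then have "G z = (\<Sum>I\<in>Pow {1..N}. G (y_wedge y I * ev (y_coef z I)))"
          by (simp only: z)
        also have "\<dots> = ?F z"
          using True G by (auto simp: extend_def y_coef_SA intro!: sum.cong)
        finally show ?thesis .
      next
        case False
        then show ?thesis using G by (auto simp: PiE_def extensional_def)
      qed
    qed
  qed
qed

text \<open>Once the anticommutator is itself an \<open>extend\<close>, the matrix identity is a
  comparison of sums over \<open>I\<close>.\<close>

lemma H_op_eq: "H_op x y N = extend (\<lambda>I A. y_wedge y I * ev (Delta N (card I) A) + N_part x y N I A)
    (\<lambda>I A. xy_wedge x y I * ev (Delta N (card I) A))"
proof (rule extend_unique[OF _ H_op_y H_op_xy])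
  show "additive (H_op x y N)"
    by (simp add: additive_def H_op_def creation_add d_R_add)
qed

lemma block_matrix:
  "has_block_matrix (Y_space x y N) (X_space x y N) (H_op x y N)
     (Delta_sum x y N) (\<lambda>w. 0) (N_op x y N) (Delta_sum x y N)"
  unfolding has_block_matrix_def
proof (intro conjI allI ballI)
  fix z
  let ?u = "\<Sum>I\<in>Pow {1..N}. y_wedge y I * ev (y_coef z I)"
  let ?w = "\<Sum>I\<in>Pow {1..N}. xy_wedge x y I * ev (xy_coef z I)"
  show "\<exists>!p. fst p \<in> Y_space x y N \<and> snd p \<in> X_space x y N \<and> z = fst p + snd p"
  proof (rule ex1I[of _ "(?u, ?w)"])
    show "fst (?u, ?w) \<in> Y_space x y N \<and> snd (?u, ?w) \<in> X_space x y N \<and> z = fst (?u, ?w) + snd (?u, ?w)"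
      using coef_decomposition[of z]
      by (auto simp del: One_nat_def intro!: Y_space_sum X_space_sum Y_space_basis X_space_basis y_coef_SA xy_coef_SA)
  next
    fix p assume p: "fst p \<in> Y_space x y N \<and> snd p \<in> X_space x y N \<and> z = fst p + snd p"
    \<comment> \<open>The coordinates of \<open>z\<close> along each family come from one component
      alone, so any decomposition must be the one read off from the coordinates.\<close>
    have c: "y_coef z I = y_coef (fst p) I" "xy_coef z I = xy_coef (snd p) I" if "I \<subseteq> {1..N}" for I
      using p that by (simp_all add: y_xy_coef_simps X_space_iff Y_space_iff)
    have pY: "fst p \<in> Y_space x y N" and pX: "snd p \<in> X_space x y N" using p by simp_all
    have "?u = fst p"
      using coef_decomposition[of "fst p"] pY by (simp add: c Y_space_iff scalar_eval_0)
    moreover have "?w = snd p"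
      using coef_decomposition[of "snd p"] pX by (simp add: c X_space_iff scalar_eval_0)
    ultimately show "p = (?u, ?w)" by (simp add: prod_eq_iff)
  qed
next
  show "Delta_sum x y N \<in> Y_space x y N \<rightarrow> Y_space x y N"
  proof
    fix u assume "u \<in> Y_space x y N"
    then have "Delta_sum x y N u = (\<Sum>I\<in>Pow {1..N}. y_wedge y I * ev (Delta N (card I) (y_coef u I)))"
      using Delta_add[of N _ 0 0] by (simp add: Delta_sum_eq extend_def Y_space_iff scalar_eval_0)
    then show "Delta_sum x y N u \<in> Y_space x y N"
      by (auto simp del: One_nat_def intro!: Y_space_sum Y_space_basis Delta_scalar_algebra y_coef_SA)
  qed
  show "Delta_sum x y N \<in> X_space x y N \<rightarrow> X_space x y N"
  proof
    fix u assume "u \<in> X_space x y N"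
    then have "Delta_sum x y N u = (\<Sum>I\<in>Pow {1..N}. xy_wedge x y I * ev (Delta N (card I) (xy_coef u I)))"
      using Delta_add[of N _ 0 0] by (simp add: Delta_sum_eq extend_def X_space_iff scalar_eval_0)
    then show "Delta_sum x y N u \<in> X_space x y N"
      by (auto simp del: One_nat_def intro!: X_space_sum X_space_basis Delta_scalar_algebra xy_coef_SA)
  qed
  show "N_op x y N \<in> Y_space x y N \<rightarrow> X_space x y N" using N_op_props(1,2) by simp
  show "(\<lambda>w. 0) \<in> X_space x y N \<rightarrow> Y_space x y N" by (simp add: Y_space_0)
next
  fix u w assume u: "u \<in> Y_space x y N" and w: "w \<in> X_space x y N"
  \<comment> \<open>Needed for the missing coordinates: \<open>u\<close> has none along x \<and> y_I
    and \<open>w\<close> none along y_I.\<close>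
  have D0: "Delta N p 0 = 0" for p using Delta_add[of N p 0 0] by simp
  show "H_op x y N (u + w) = Delta_sum x y N u + 0 + (N_op x y N u + Delta_sum x y N w)"
    using u w
    by (simp add: H_op_eq Delta_sum_eq N_op_props(1) extend_def y_xy_coef_simps Y_space_iff X_space_iff
        scalar_eval_0 D0 sum.distrib add_ac)
qed

end

theorem theorem4p2:
  fixes x :: 'v and y :: "nat \<Rightarrow> 'v" and N :: nat
  assumes "bij_betw y {1..N} (UNIV - {x})"
  shows "(\<forall>I A. I \<subseteq> {1..N} \<longrightarrow> A \<in> scalar_algebra N \<longrightarrow>
        H_op x y N (xy_wedge x y I * scalar_eval x y A)
          = xy_wedge x y I * scalar_eval x y (Delta N (card I) A) \<and>
        H_op x y N (y_wedge y I * scalar_eval x y A)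
          = y_wedge y I * scalar_eval x y (Delta N (card I) A) + N_part x y N I A \<and>
        N_part x y N I A \<in> X_space x y N) \<and>
      N_op x y N \<in> Y_space x y N \<rightarrow> X_space x y N \<and>
      (\<forall>I A. I \<subseteq> {1..N} \<longrightarrow> A \<in> scalar_algebra N \<longrightarrow>
        N_op x y N (y_wedge y I * scalar_eval x y A) = N_part x y N I A) \<and>
      has_block_matrix (Y_space x y N) (X_space x y N) (H_op x y N)
        (Delta_sum x y N) (\<lambda>w. 0)
        (N_op x y N)      (Delta_sum x y N)"
proof -
  interpret radial_vars x y N by standard (rule assms)
  show ?thesis
    by (intro conjI allI impI H_op_xy H_op_y N_part_X_space block_matrix)
      (simp_all only: N_op_props)
qed

end
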